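(* Let $\mathcal{M}$ be a factor von Neumann algebra with $\dim\mathcal{M}\geq 2$. Then a map $\Phi:\mathcal{M}\rightarrow\mathcal{M}$ is a nonlinear mixed Jordan triple $*$-derivation if and only if $\Phi$ is an additive $*$-derivation.
   Context: A von Neumann algebra $\mathcal{M}$ is a weakly closed, self-adjoint algebra of operators on a complex Hilbert space $\mathcal{H}$ containing the identity operator $I$; it is a factor if its center contains only the scalar operators. For $A,B\in\mathcal{M}$, define $[A,B]_{*}=AB-BA^{*}$ and $A\bullet B=AB+BA^{*}$. A (not necessarily additive or linear) map $\Phi:\mathcal{M}\to\mathcal{M}$ is a nonlinear mixed Jordan triple $*$-derivation if $\Phi([A\bullet B, C]_{*})=[\Phi(A)\bullet B, C]_{*}+[A\bullet \Phi(B), C]_{*}+[A\bullet B, \Phi(C)]_{*}$ for all $A,B,C\in\mathcal{M}$. An additive $*$-derivation on $\mathcal{M}$ is an additive map $\Phi:\mathcal{M}\to\mathcal{M}$ (no homogeneity over $\mathbb{C}$ is assumed) such that $\Phi(AB)=\Phi(A)B+A\Phi(B)$ for all $A,B\in\mathcal{M}$ and $\Phi(A^{*})=\Phi(A)^{*}$ for all $A\in\mathcal{M}$. *)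

theory Defs
  imports "HOL-Analysis.Analysis"
begin

section \<open>Complex Hilbert spaces\<close>

class complex_vector = real_vector +
  fixes scaleC :: "complex \<Rightarrow> 'a \<Rightarrow> 'a" (infixr \<open>*\<^sub>C\<close> 75)
  assumes scaleC_add_right: "a *\<^sub>C (x + y) = a *\<^sub>C x + a *\<^sub>C y"
    and scaleC_add_left: "(a + b) *\<^sub>C x = a *\<^sub>C x + b *\<^sub>C x"
    and scaleC_scaleC: "a *\<^sub>C (b *\<^sub>C x) = (a * b) *\<^sub>C x"
    and scaleC_one: "1 *\<^sub>C x = x"
    and scaleR_scaleC: "r *\<^sub>R x = complex_of_real r *\<^sub>C x"

global_interpretation complex_vector: vector_space "scaleC :: complex \<Rightarrow> 'a \<Rightarrow> 'a::complex_vector"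
  by unfold_locales (simp_all add: scaleC_add_right scaleC_add_left scaleC_scaleC scaleC_one)

text \<open>The complex inner product is linear in its first argument and conjugate-linear in its
  second.  The real inner product is required to be its real part, so the norm inherited from
  \<open>real_inner\<close> is the usual Hilbert space norm.\<close>

class complex_inner = complex_vector + real_inner +
  fixes cinner :: "'a \<Rightarrow> 'a \<Rightarrow> complex"
  assumes cinner_commute: "cinner x y = cnj (cinner y x)"
    and cinner_add_left: "cinner (x + y) z = cinner x z + cinner y z"
    and cinner_scaleC_left: "cinner (c *\<^sub>C x) y = c * cinner x y"
    and inner_eq_Re_cinner: "inner x y = Re (cinner x y)"

class chilbert_space = complex_inner + complete_space

lemma cinner_scaleC_right: "cinner x (c *\<^sub>C y) = cnj c * cinner x y"
  by (metis cinner_commute cinner_scaleC_left complex_cnj_mult)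

lemma norm_scaleC: "norm (c *\<^sub>C x) = cmod c * norm (x :: 'a::complex_inner)"
proof -
  have "inner (c *\<^sub>C x) (c *\<^sub>C x) = Re ((c * cnj c) * cinner x x)"
    by (simp add: inner_eq_Re_cinner cinner_scaleC_left cinner_scaleC_right algebra_simps)
  also have "\<dots> = (cmod c)\<^sup>2 * inner x x"
    unfolding complex_norm_square [symmetric] by (simp add: inner_eq_Re_cinner)
  finally show ?thesis
    by (simp add: norm_eq_sqrt_inner real_sqrt_mult)
qed

lemma bounded_linear_scaleC: "bounded_linear (\<lambda>x :: 'a::complex_inner. c *\<^sub>C x)"
  by (rule bounded_linear_intro [where K = "cmod c"])
    (simp_all add: scaleC_add_right scaleR_scaleC scaleC_scaleC mult.commute norm_scaleC)


section \<open>Bounded operators\<close>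

instantiation blinfun :: (real_normed_vector, complex_inner) complex_vector
begin

lift_definition scaleC_blinfun :: "complex \<Rightarrow> 'a \<Rightarrow>\<^sub>L 'b \<Rightarrow> 'a \<Rightarrow>\<^sub>L 'b" is "\<lambda>c f x. c *\<^sub>C f x"
  by (rule bounded_linear_compose [OF bounded_linear_scaleC])

instance
  by standard
    (transfer; simp add: scaleC_add_right scaleC_add_left scaleC_scaleC scaleC_one scaleR_scaleC)+

end

text \<open>The type \<open>'a \<Rightarrow>\<^sub>L 'a\<close> consists of the bounded \<^emph>\<open>real\<close>-linear maps;
  the bounded operators on the complex Hilbert space are the following subset.\<close>

definition bounded_operators :: "('a::complex_inner \<Rightarrow>\<^sub>L 'a) set" where
  "bounded_operators = {A. \<forall>c x. blinfun_apply A (c *\<^sub>C x) = c *\<^sub>C A x}"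

definition cadjoint :: "('a::chilbert_space \<Rightarrow>\<^sub>L 'a) \<Rightarrow> ('a \<Rightarrow>\<^sub>L 'a)" where
  "cadjoint A = (THE B. \<forall>x y. cinner (A x) y = cinner x (blinfun_apply B y))"

text \<open>The remainder of this section shows that the description is proper for bounded operators.\<close>

lemma riesz_representation_real:
  fixes f :: "'a::{real_inner, complete_space} \<Rightarrow> real"
  assumes f: "bounded_linear f"
  shows "\<exists>z. \<forall>x. f x = inner x z"
proof -
  interpret f: bounded_linear f by (rule f)
  obtain K where K: "\<And>x. \<bar>f x\<bar> \<le> norm x * K"
    using f.bounded by auto
  define g where "g x = inner x x - 2 * f x" for x
  have lower: "- K\<^sup>2 \<le> g x" for x
  proof -
    have "0 \<le> (norm x - K)\<^sup>2" by simp
    moreover have "f x \<le> norm x * K" using K [of x] by linarith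
    ultimately show ?thesis
      by (simp add: g_def power2_norm_eq_inner [symmetric] power2_diff)
  qed
  define m where "m = Inf (range g)"
  have bdd: "bdd_below (range g)"
    using lower by (auto simp: bdd_below_def)
  have m_le: "m \<le> g x" for x
    unfolding m_def using bdd by (rule cInf_lower [rotated]) simp
  have "\<exists>x. g x < m + 1 / real (Suc n)" for n
    using cInf_lessD [of "range g" "m + 1 / real (Suc n)"] by (auto simp: m_def)
  then obtain X where X: "\<And>n. g (X n) < m + 1 / real (Suc n)" by metis
  have par: "(norm (x - y))\<^sup>2 = 2 * g x + 2 * g y - 4 * g ((1 / 2) *\<^sub>R (x + y))" for x y
    unfolding g_def power2_norm_eq_inner
    by (simp add: f.scaleR f.add inner_add_left inner_add_right inner_diff_left inner_diff_right
        inner_commute [of y x] algebra_simps)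
  have "Cauchy X"
  proof (rule CauchyI)
    fix e :: real assume "0 < e"
    then obtain N where N: "inverse (real (Suc N)) < e\<^sup>2 / 4"
      using reals_Archimedean [of "e\<^sup>2 / 4"] by auto
    have "norm (X i - X j) < e" if "N \<le> i" "N \<le> j" for i j
    proof -
      have "1 / real (Suc i) \<le> inverse (real (Suc N))" "1 / real (Suc j) \<le> inverse (real (Suc N))"
        using that by (auto simp: field_simps)
      then have "(norm (X i - X j))\<^sup>2 < e\<^sup>2"
        using par [of "X i" "X j"] X [of i] X [of j] m_le [of "(1 / 2) *\<^sub>R (X i + X j)"] N
        by linarith
      with \<open>0 < e\<close> show ?thesis by (simp add: power2_less_imp_less)
    qed
    then show "\<exists>M. \<forall>i\<ge>M. \<forall>j\<ge>M. norm (X i - X j) < e" by blast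
  qed
  then obtain z where z: "X \<longlonglongrightarrow> z"
    using Cauchy_convergent_iff convergent_def by blast
  have "(\<lambda>n. g (X n)) \<longlonglongrightarrow> g z"
    unfolding g_def
    by (intro tendsto_diff tendsto_mult tendsto_const tendsto_inner z f.tendsto)
  moreover have "(\<lambda>n. m + 1 / real (Suc n)) \<longlonglongrightarrow> m + 0"
    using LIMSEQ_inverse_real_of_nat
    by (intro tendsto_add tendsto_const) (simp add: inverse_eq_divide)
  ultimately have "g z \<le> m + 0"
    using X by (intro LIMSEQ_le) (auto intro: less_imp_le)
  then have min: "g z \<le> g x" for x
    using m_le [of x] by linarith
  have "f y = inner y z" for y
  proof (cases "y = 0")
    case False
    define d where "d = inner y z - f y"
    define t where "t = - d / inner y y"
    have pos: "inner y y > 0" using False by simp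
    have "g (z + t *\<^sub>R y) - g z = t * t * inner y y + 2 * t * d"
      by (simp add: g_def d_def f.add f.scaleR inner_add_left inner_add_right
          inner_commute [of z y] algebra_simps)
    also have "\<dots> = - (d * d / inner y y)"
      using pos by (simp add: t_def field_simps)
    finally have "d * d / inner y y \<le> 0"
      using min [of "z + t *\<^sub>R y"] by linarith
    with pos have "d * d \<le> 0" by (simp add: divide_le_0_iff del: inner_gt_zero_iff)
    then have "d = 0" by (metis zero_le_square antisym mult_eq_0_iff)
    then show ?thesis by (simp add: d_def)
  qed (simp add: f.zero)
  then show ?thesis by blast
qed

lemma cinner_eq_inner: "cinner x y = Complex (inner x y) (- inner (\<i> *\<^sub>C x) y)"
  by (simp add: complex_eq_iff inner_eq_Re_cinner cinner_scaleC_left)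

lemma cadjoint_unique:
  fixes A :: "'a::chilbert_space \<Rightarrow>\<^sub>L 'a"
  assumes "\<And>x y. cinner (A x) y = cinner x (blinfun_apply B y)"
  shows "cadjoint A = B"
  unfolding cadjoint_def
proof (rule the_equality)
  fix B' assume B': "\<forall>x y. cinner (A x) y = cinner x (blinfun_apply B' y)"
  show "B' = B"
  proof (rule blinfun_eqI)
    fix y
    have "inner x (B' y) = inner x (B y)" for x
      using B' assms by (simp add: inner_eq_Re_cinner)
    then show "B' y = B y" by (rule vector_eq_ldot [THEN iffD1, OF allI])
  qed
qed (use assms in blast)

lemma cinner_cadjoint:
  fixes A :: "'a::chilbert_space \<Rightarrow>\<^sub>L 'a"
  assumes A: "A \<in> bounded_operators"
  shows "cinner (A x) y = cinner x (cadjoint A y)"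
proof -
  have "\<exists>z. \<forall>x. inner (A x) y = inner x z" for y
    by (rule riesz_representation_real) (intro bounded_linear_intros)
  then obtain B where B: "\<And>x y. inner (A x) y = inner x (B y)" by metis
  have "bounded_linear B"
  proof (rule bounded_linear_intro [where K = "norm A"])
    fix u v :: 'a and r :: real
    have "inner x (B (u + v)) = inner x (B u + B v)" for x
      by (simp add: B [symmetric] inner_add_right)
    then show "B (u + v) = B u + B v" by (rule vector_eq_ldot [THEN iffD1, OF allI])
    have "inner x (B (r *\<^sub>R u)) = inner x (r *\<^sub>R B u)" for x
      by (simp add: B [symmetric])
    then show "B (r *\<^sub>R u) = r *\<^sub>R B u" by (rule vector_eq_ldot [THEN iffD1, OF allI])
    have "norm (B u) * norm (B u) = inner (A (B u)) u"
      by (simp add: B power2_norm_eq_inner [symmetric] power2_eq_square)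
    also have "\<dots> \<le> norm (A (B u)) * norm u" by (rule norm_cauchy_schwarz)
    also have "\<dots> \<le> (norm A * norm (B u)) * norm u"
      by (intro mult_right_mono norm_blinfun) simp
    finally have "norm (B u) * norm (B u) \<le> norm (B u) * (norm u * norm A)"
      by (simp add: mult_ac)
    then show "norm (B u) \<le> norm u * norm A"
      by (cases "B u = 0") auto
  qed
  then have app: "blinfun_apply (Blinfun B) = B" by (rule bounded_linear_Blinfun_apply)
  have adj: "cinner (A x) y = cinner x (Blinfun B y)" for x y
    unfolding cinner_eq_inner app B [symmetric]
    using A by (simp add: bounded_operators_def)
  with cadjoint_unique [OF adj] show ?thesis by simp
qed


section \<open>Factor von Neumann algebras\<close>

definition weak_operator_topology :: "('a::complex_inner \<Rightarrow>\<^sub>L 'a) topology" where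
  "weak_operator_topology =
     pullback_topology bounded_operators (\<lambda>A (x, y). cinner (blinfun_apply A x) y)
       (product_topology (\<lambda>_. euclidean) UNIV)"

definition von_neumann_algebra :: "('a::chilbert_space \<Rightarrow>\<^sub>L 'a) set \<Rightarrow> bool" where
  "von_neumann_algebra M \<longleftrightarrow>
     M \<subseteq> bounded_operators \<and>
     complex_vector.subspace M \<and>
     (\<forall>A\<in>M. \<forall>B\<in>M. A o\<^sub>L B \<in> M) \<and>
     (\<forall>A\<in>M. cadjoint A \<in> M) \<and>
     id_blinfun \<in> M \<and>
     closedin weak_operator_topology M"

definition center :: "('a::real_normed_vector \<Rightarrow>\<^sub>L 'a) set \<Rightarrow> ('a \<Rightarrow>\<^sub>L 'a) set" where
  "center M = {Z \<in> M. \<forall>A\<in>M. Z o\<^sub>L A = A o\<^sub>L Z}"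

definition factor_von_neumann_algebra :: "('a::chilbert_space \<Rightarrow>\<^sub>L 'a) set \<Rightarrow> bool" where
  "factor_von_neumann_algebra M \<longleftrightarrow>
     von_neumann_algebra M \<and> center M \<subseteq> {c *\<^sub>C id_blinfun | c. True}"

text \<open>Since \<open>complex_vector.dim\<close> is \<open>0\<close> on infinite-dimensional spaces, a lower bound on the
  dimension is expressed through the cardinality of a basis, which may be infinite.\<close>

definition cdim_at_least :: "nat \<Rightarrow> 'a::complex_vector set \<Rightarrow> bool" where
  "cdim_at_least n V \<longleftrightarrow>
     (\<exists>B\<subseteq>V. complex_vector.independent B \<and> complex_vector.span B = V \<and>
        (infinite B \<or> n \<le> card B))"


section \<open>Derivations\<close>

definition skew_lie_product ::
    "('a::chilbert_space \<Rightarrow>\<^sub>L 'a) \<Rightarrow> ('a \<Rightarrow>\<^sub>L 'a) \<Rightarrow> ('a \<Rightarrow>\<^sub>L 'a)" (\<open>[_,/ _]\<^sub>*\<close>) where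
  "[A, B]\<^sub>* = (A o\<^sub>L B) - (B o\<^sub>L cadjoint A)"

definition jordan_star_product ::
    "('a::chilbert_space \<Rightarrow>\<^sub>L 'a) \<Rightarrow> ('a \<Rightarrow>\<^sub>L 'a) \<Rightarrow> ('a \<Rightarrow>\<^sub>L 'a)" (infixl \<open>\<bullet>\<^sub>*\<close> 70) where
  "A \<bullet>\<^sub>* B = (A o\<^sub>L B) + (B o\<^sub>L cadjoint A)"

definition mixed_jordan_triple_star_derivation ::
    "('a::chilbert_space \<Rightarrow>\<^sub>L 'a) set \<Rightarrow> (('a \<Rightarrow>\<^sub>L 'a) \<Rightarrow> ('a \<Rightarrow>\<^sub>L 'a)) \<Rightarrow> bool" where
  "mixed_jordan_triple_star_derivation M \<Phi> \<longleftrightarrow>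
     (\<forall>A\<in>M. \<forall>B\<in>M. \<forall>C\<in>M.
        \<Phi> [A \<bullet>\<^sub>* B, C]\<^sub>* =
          [\<Phi> A \<bullet>\<^sub>* B, C]\<^sub>* + [A \<bullet>\<^sub>* \<Phi> B, C]\<^sub>* + [A \<bullet>\<^sub>* B, \<Phi> C]\<^sub>*)"

definition additive_star_derivation ::
    "('a::chilbert_space \<Rightarrow>\<^sub>L 'a) set \<Rightarrow> (('a \<Rightarrow>\<^sub>L 'a) \<Rightarrow> ('a \<Rightarrow>\<^sub>L 'a)) \<Rightarrow> bool" where
  "additive_star_derivation M \<Phi> \<longleftrightarrow>
     (\<forall>A\<in>M. \<forall>B\<in>M. \<Phi> (A + B) = \<Phi> A + \<Phi> B) \<and>
     (\<forall>A\<in>M. \<forall>B\<in>M. \<Phi> (A o\<^sub>L B) = (\<Phi> A o\<^sub>L B) + (A o\<^sub>L \<Phi> B)) \<and>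
     (\<forall>A\<in>M. \<Phi> (cadjoint A) = cadjoint (\<Phi> A))"

end

theory Submission
  imports Defs
begin

text \<open>
The triple product is \<open>T(A, B, C) = (AB + BA\<^sup>*)C - C(AB + BA\<^sup>*)\<^sup>*\<close>, additive in each
argument.  That an additive \<open>*\<close>-derivation satisfies the triple identity is therefore the product
rule applied to each term (\<open>derivation_triple\<close>).  The converse has an easy half and a hard half.

The easy half starts from an additive \<open>\<Phi>\<close>.  Evaluating the identity at triples built from \<open>1\<close>,
\<open>\<i>\<close> and self-adjoint elements makes most of the terms vanish: one finds that \<open>\<Phi> 1\<close> is self-adjoint
and central, that \<open>\<Phi>\<close> preserves self-adjointness, and then that \<open>\<Phi> 1 = 0\<close> and \<open>\<Phi> \<i> = 0\<close>.  So
\<open>\<Phi>\<close> is linear over \<open>\<i>\<close>, commutes with the adjoint and derives \<open>BC - CB\<^sup>*\<close>; taking \<open>B\<close> and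
\<open>\<i>B\<close> with \<open>B\<close> self-adjoint gives the product rule for commutators and for anticommutators, and
half their sum is the product rule.

The hard half is that \<open>\<Phi>\<close> is additive.  Let \<open>P\<close> be a projection other than \<open>0\<close> and \<open>1\<close>, let
\<open>Q = 1 - P\<close>, and consider the defect \<open>D = \<Phi>(X + Y) - \<Phi> X - \<Phi> Y\<close>.  If \<open>\<Phi>\<close> is already known to be
additive on the values \<open>T(A, B, X)\<close> and \<open>T(A, B, Y)\<close>, for instance because one of them is zero, then
subtracting the identities gives \<open>T(A, B, D) = 0\<close>; the same holds in the second slot.  Suitable
choices of the other two arguments kill the Peirce corners of \<open>D\<close> one after another when \<open>X\<close> and
\<open>Y\<close> lie in different corners.  For \<open>X\<close>, \<open>Y\<close> in the same off-diagonal corner one expands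
\<open>T(1, P + X, Q + Y)\<close>, and for \<open>X\<close>, \<open>Y\<close> in the same diagonal corner multiplication by off-diagonal
elements leads to \<open>D M Q = 0\<close> or \<open>D M P = 0\<close>.  Here primeness enters: \<open>A M B = 0\<close> forces \<open>A = 0\<close> or
\<open>B = 0\<close>.

It remains to find \<open>P\<close> and to prove primeness in a factor.  Both come from the sign of a
self-adjoint \<open>A\<close>, which for a contraction is the strong limit of the iteration
\<open>A \<mapsto> A(3 - A\<^sup>2)/2\<close> (\<open>contraction_sign\<close>).
If \<open>S\<close> is the sign of \<open>A\<close>, then \<open>S\<^sup>2\<close> is the projection onto the closed range of \<open>A\<close>, and
\<open>(S\<^sup>2 + S)/2\<close> is a nontrivial projection as soon as the quadratic form of \<open>A\<close> takes both signs; a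
non-scalar algebra contains such an \<open>A\<close>.  For primeness, the projections \<open>R\<close> with \<open>A M R = 0\<close> form a
directed set, because sums have range projections.  They converge strongly to a projection \<open>E\<close>, which
is central since \<open>{T. A M T = 0}\<close> is a two-sided ideal on which \<open>E\<close> acts as the identity.  In a factor
\<open>E\<close> is \<open>0\<close> or \<open>1\<close>, so either the ideal is zero or \<open>A = A E = 0\<close>.
\<close>

section \<open>Star algebras and Peirce corners\<close>

text \<open>The element \<open>j\<close> plays the part of the imaginary unit.  The operations are total on the type
\<open>'r\<close>, so algebraic identities hold without membership conditions, and only \<open>M\<close> carries closure
conditions.  The sort omits \<open>0 \<noteq> 1\<close>, which fails for the operators on the zero space.\<close>

locale unital_star_algebra =
  fixes M :: "'r::{real_algebra,monoid_mult} set"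
    and star :: "'r \<Rightarrow> 'r"
    and j :: 'r
  assumes add_closed [intro, simp]: "x \<in> M \<Longrightarrow> y \<in> M \<Longrightarrow> x + y \<in> M"
    and mult_closed [intro, simp]: "x \<in> M \<Longrightarrow> y \<in> M \<Longrightarrow> x * y \<in> M"
    and scaleR_closed [intro, simp]: "x \<in> M \<Longrightarrow> r *\<^sub>R x \<in> M"
    and star_closed [intro, simp]: "x \<in> M \<Longrightarrow> star x \<in> M"
    and one_closed [intro, simp]: "1 \<in> M"
    and j_closed [intro, simp]: "j \<in> M"
    and star_add [simp]: "star (x + y) = star x + star y"
    and star_mult [simp]: "star (x * y) = star y * star x"
    and star_star [simp]: "star (star x) = x"
    and star_scaleR [simp]: "star (r *\<^sub>R x) = r *\<^sub>R star x"
    and star_j [simp]: "star j = - j"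
    and j_square [simp]: "j * j = - 1"
    and j_central: "x * j = j * x"
begin

lemma minus_closed [intro, simp]: "x \<in> M \<Longrightarrow> - x \<in> M"
  using scaleR_closed [of x "-1"] by simp

lemma diff_closed [intro, simp]: "x \<in> M \<Longrightarrow> y \<in> M \<Longrightarrow> x - y \<in> M"
  using add_closed [of x "- y"] by simp

lemma zero_closed [intro, simp]: "0 \<in> M"
  using scaleR_closed [OF one_closed, of 0] by simp

lemma star_zero [simp]: "star 0 = 0"
  using star_scaleR [of 0 0] by simp

lemma star_minus [simp]: "star (- x) = - star x"
  using star_scaleR [of "-1" x] by simp

lemma star_diff [simp]: "star (x - y) = star x - star y"
  using star_add [of x "- y"] by simp

lemma star_one [simp]: "star 1 = 1"
  by (metis mult_1 star_mult star_star)

lemma j_cancel: "x = 0" if "j * x = 0"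
proof -
  have "j * j * x = 0" unfolding mult.assoc that by simp
  then show ?thesis by simp
qed

lemma double_eq_0 [simp]: "(x::'r) + x = 0 \<longleftrightarrow> x = 0"
  by (metis scaleR_2 scaleR_eq_0_iff zero_neq_numeral)

lemma neg_eq_self [simp]: "- (x::'r) = x \<longleftrightarrow> x = 0"
  by (metis add.left_inverse double_eq_0 neg_equal_0_iff_equal)

lemma halve:
  fixes x y :: 'r shows "x + x = y + y \<Longrightarrow> x = y"
  using double_eq_0 [of "x - y"] by (simp add: algebra_simps)

lemma real_imaginary_parts:
  assumes "X \<in> M"
  obtains A B where "A \<in> M" "B \<in> M" "star A = A" "star B = B" "X = A + j * B"
proof (rule that [of "(1/2) *\<^sub>R (X + star X)" "(1/2) *\<^sub>R (- j * (X - star X))"])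
  show "(1/2) *\<^sub>R (X + star X) \<in> M" "(1/2) *\<^sub>R (- j * (X - star X)) \<in> M"
    using assms by auto
  show "star ((1/2) *\<^sub>R (X + star X)) = (1/2) *\<^sub>R (X + star X)" by (simp add: add.commute)
  show "star ((1/2) *\<^sub>R (- j * (X - star X))) = (1/2) *\<^sub>R (- j * (X - star X))"
    by (simp add: j_central [of "star X"] j_central [of X] algebra_simps)
  have "j * (1/2) *\<^sub>R (- j * (X - star X)) = (1/2) *\<^sub>R (X - star X)"
    by (simp add: scaleR_right_diff_distrib flip: mult.assoc)
  then show "X = (1/2) *\<^sub>R (X + star X) + j * (1/2) *\<^sub>R (- j * (X - star X))"
    by (simp add: scaleR_left_distrib [symmetric] algebra_simps)
qed

definition skew :: "'r \<Rightarrow> 'r \<Rightarrow> 'r" where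
  "skew B C = B * C - C * star B"

definition triple :: "'r \<Rightarrow> 'r \<Rightarrow> 'r \<Rightarrow> 'r" where
  "triple A B C = skew (A * B + B * star A) C"

lemma skew_closed [simp]: "B \<in> M \<Longrightarrow> C \<in> M \<Longrightarrow> skew B C \<in> M"
  by (simp add: skew_def)

lemma triple_closed [simp]: "A \<in> M \<Longrightarrow> B \<in> M \<Longrightarrow> C \<in> M \<Longrightarrow> triple A B C \<in> M"
  by (simp add: triple_def)

lemma skew_add_right: "skew B (C + D) = skew B C + skew B D"
  by (simp add: skew_def algebra_simps)

lemma skew_add_left: "skew (A + B) C = skew A C + skew B C"
  by (simp add: skew_def algebra_simps)

lemma skew_diff_right: "skew B (C - D) = skew B C - skew B D"
  by (simp add: skew_def algebra_simps)

lemma skew_diff_left: "skew (A - B) C = skew A C - skew B C"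
  by (simp add: skew_def algebra_simps)

lemma skew_scaleR_left: "skew (r *\<^sub>R A) C = r *\<^sub>R skew A C"
  by (simp add: skew_def algebra_simps)

lemma triple_one: "triple 1 B C = skew B C + skew B C"
  by (simp add: triple_def skew_add_left)

lemma triple_one_half: "triple 1 ((1/2) *\<^sub>R B) C = skew B C"
  by (simp add: triple_one skew_scaleR_left scaleR_left_distrib [symmetric])

lemma skew_times_j: "skew (j * B) C = j * (B * C + C * star B)"
proof -
  have "C * (star B * j) = j * (C * star B)" by (simp add: j_central [of "C * star B"] flip: mult.assoc)
  then show ?thesis by (simp add: skew_def algebra_simps)
qed

lemma skew_j_self_adjoint:
  assumes "star H = H" shows "skew (j * H) X = j * (H * X + X * H)"
  using assms by (simp add: skew_times_j)

text \<open>Complementary projections are kept as a pair so that every statement about \<open>P\<close>, \<open>Q\<close>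
can be reused with the roles of the two exchanged.\<close>

definition complementary :: "'r \<Rightarrow> 'r \<Rightarrow> bool" where
  "complementary P Q \<longleftrightarrow> P \<in> M \<and> star P = P \<and> P * P = P \<and> P + Q = 1"

definition corner :: "'r \<Rightarrow> 'r \<Rightarrow> 'r set" where
  "corner P Q = {X \<in> M. P * X = X \<and> X * Q = X}"

lemma complementaryD:
  assumes "complementary P Q"
  shows "P \<in> M" "Q \<in> M" "star P = P" "star Q = Q" "P * P = P" "Q * Q = Q" "P * Q = 0" "Q * P = 0"
    "P + Q = 1"
proof -
  have Q: "Q = 1 - P" and *: "P \<in> M" "star P = P" "P * P = P" "P + Q = 1"
    using assms by (auto simp: complementary_def algebra_simps)
  show "P \<in> M" "Q \<in> M" "star P = P" "star Q = Q" "P * P = P" "Q * Q = Q" "P * Q = 0" "Q * P = 0"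
    "P + Q = 1"
    using * unfolding Q by (simp_all add: algebra_simps)
qed

lemma complementary_absorb:
  assumes "complementary P Q"
  shows "P * (P * X) = P * X" "Q * (Q * X) = Q * X" "P * (Q * X) = 0" "Q * (P * X) = 0"
  using complementaryD [OF assms] by (simp_all flip: mult.assoc)

lemma complementary_sym:
  assumes "complementary P Q" shows "complementary Q P"
  using complementaryD [OF assms] unfolding complementary_def by (metis add.commute)

lemma cornerD:
  assumes "complementary P Q"
  shows "X \<in> corner P P \<Longrightarrow> X \<in> M \<and> P * X = X \<and> X * P = X \<and> Q * X = 0 \<and> X * Q = 0"
    and "X \<in> corner P Q \<Longrightarrow> X \<in> M \<and> P * X = X \<and> X * P = 0 \<and> Q * X = 0 \<and> X * Q = X"
proof -
  note c = complementaryD [OF assms]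
  have "Q * X = 0" if "P * X = X"
    by (metis that c(8) mult.assoc mult_zero_left)
  moreover have "X * Q = 0" if "X * P = X"
    by (metis that c(7) mult.assoc mult_zero_right)
  moreover have "X * P = 0" if "X * Q = X"
    by (metis that c(8) mult.assoc mult_zero_right)
  ultimately show "X \<in> corner P P \<Longrightarrow> X \<in> M \<and> P * X = X \<and> X * P = X \<and> Q * X = 0 \<and> X * Q = 0"
    and "X \<in> corner P Q \<Longrightarrow> X \<in> M \<and> P * X = X \<and> X * P = 0 \<and> Q * X = 0 \<and> X * Q = X"
    by (auto simp: corner_def)
qed

text \<open>For complementary \<open>P\<close>, \<open>Q\<close> these are the elements \<open>X\<close> of \<open>M\<close> with \<open>P X P = 0\<close> and \<open>Q X Q = 0\<close>; the commutation rules in the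
definition are the form in which this is used.\<close>

definition off_diagonal :: "'r \<Rightarrow> 'r \<Rightarrow> 'r set" where
  "off_diagonal P Q = {X \<in> M. P * X = X * Q \<and> Q * X = X * P}"

lemma corner_off_diagonal:
  assumes "complementary P Q"
  shows "corner P Q \<subseteq> off_diagonal P Q" "corner Q P \<subseteq> off_diagonal P Q"
  using cornerD(2) [OF assms] cornerD(2) [OF complementary_sym [OF assms]]
  by (auto simp: off_diagonal_def)

lemma off_diagonal_add:
  "X \<in> off_diagonal P Q \<Longrightarrow> Y \<in> off_diagonal P Q \<Longrightarrow> X + Y \<in> off_diagonal P Q"
  by (auto simp: off_diagonal_def algebra_simps)

lemma off_diagonal_sym: "off_diagonal P Q = off_diagonal Q P"
  by (auto simp: off_diagonal_def)

lemma corner_add: "X \<in> corner P Q \<Longrightarrow> Y \<in> corner P Q \<Longrightarrow> X + Y \<in> corner P Q"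
  by (auto simp: corner_def algebra_simps)

lemma corner_mult:
  assumes "V \<in> corner P P'" "W \<in> corner Q' Q" shows "V * W \<in> corner P Q"
proof -
  have "P * (V * W) = P * V * W" "V * W * Q = V * (W * Q)" by (simp_all add: mult.assoc)
  then show ?thesis using assms by (simp add: corner_def)
qed

lemma corner_star:
  assumes "star P = P" "star Q = Q" "X \<in> corner P Q" shows "star X \<in> corner Q P"
proof -
  have "Q * star X = star (X * Q)" "star X * P = star (P * X)" by (simp_all add: assms(1,2))
  then show ?thesis using assms(3) by (simp add: corner_def del: star_mult)
qed

lemma peirce_decomposition:
  assumes "complementary P Q"
  shows "X = P * X * P + (P * X * Q + Q * X * P) + Q * X * Q"
proof -
  have "X = (P + Q) * X * (P + Q)"
    using complementaryD(9) [OF assms] by simp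
  then show ?thesis by (simp add: algebra_simps)
qed

lemma corner_sandwich:
  assumes "complementary P Q" "X \<in> M"
  shows "P * X * P \<in> corner P P" "P * X * Q \<in> corner P Q" "Q * X * P \<in> corner Q P" "Q * X * Q \<in> corner Q Q"
  using complementaryD [OF assms(1)] assms(2)
  by (auto simp: corner_def mult.assoc complementary_absorb [OF assms(1)])

text \<open>On these arguments the second term \<open>W V\<^sup>*\<close> of the skew product vanishes, since
\<open>W = W Q\<close> and \<open>V\<^sup>* = P V\<^sup>*\<close>, so the skew product becomes an ordinary one.\<close>

lemma skew_corner:
  assumes c: "complementary P Q" and V: "V \<in> corner P P" and W: "W \<in> corner P Q"
  shows "skew V W = V * W"
proof -
  have "star V \<in> corner P P" using V complementaryD [OF c] by (auto intro: corner_star)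
  then have "W * star V = W * P * star V" by (simp add: corner_def mult.assoc)
  then show ?thesis using cornerD(2) [OF c W] by (simp add: skew_def)
qed

text \<open>Compressing \<open>Q D + D Q = 0\<close> to a corner other than \<open>P, P\<close> returns the corner of \<open>D\<close> once or
twice, so only the \<open>P, P\<close> corner of \<open>D\<close> survives.\<close>

lemma corner_of_anticommutator:
  assumes c: "complementary P Q" and D: "D \<in> M" and *: "Q * D + D * Q = 0"
  shows "D \<in> corner P P"
proof -
  note cp = complementaryD [OF c]
  have "Q * (Q * D + D * Q) * Q = 0" "Q * (Q * D + D * Q) * P = 0" "P * (Q * D + D * Q) * Q = 0"
    using * by simp_all
  then have "Q * D * Q + Q * D * Q = 0" and off: "Q * D * P = 0" "P * D * Q = 0"
    by (simp_all add: cp complementary_absorb [OF c] algebra_simps)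
  then have "Q * D * Q = 0" by simp
  with off have "P * D * P = D"
    by (subst (2) peirce_decomposition [OF c, of D]) simp
  then show ?thesis using corner_sandwich(1) [OF c D] by simp
qed

end

lemma (in unital_star_algebra) derivation_triple:
  assumes maps: "\<And>X. X \<in> M \<Longrightarrow> \<Phi> X \<in> M"
    and add: "\<And>X Y. X \<in> M \<Longrightarrow> Y \<in> M \<Longrightarrow> \<Phi> (X + Y) = \<Phi> X + \<Phi> Y"
    and mult: "\<And>X Y. X \<in> M \<Longrightarrow> Y \<in> M \<Longrightarrow> \<Phi> (X * Y) = \<Phi> X * Y + X * \<Phi> Y"
    and star: "\<And>X. X \<in> M \<Longrightarrow> \<Phi> (star X) = star (\<Phi> X)"
    and "A \<in> M" "B \<in> M" "C \<in> M"
  shows "\<Phi> (triple A B C) = triple (\<Phi> A) B C + triple A (\<Phi> B) C + triple A B (\<Phi> C)"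
proof -
  have diff: "\<Phi> (X - Y) = \<Phi> X - \<Phi> Y" if "X \<in> M" "Y \<in> M" for X Y
    using add [of "X - Y" Y] that by (simp add: algebra_simps)
  show ?thesis
    using assms(5-) by (simp add: triple_def skew_def maps add mult star diff algebra_simps)
qed

section \<open>Additive maps satisfying the triple identity\<close>

locale mixed_triple_derivation = unital_star_algebra +
  fixes \<Phi> :: "'a \<Rightarrow> 'a"
  assumes map_closed [simp]: "X \<in> M \<Longrightarrow> \<Phi> X \<in> M"
    and map_triple: "A \<in> M \<Longrightarrow> B \<in> M \<Longrightarrow> C \<in> M \<Longrightarrow>
      \<Phi> (triple A B C) = triple (\<Phi> A) B C + triple A (\<Phi> B) C + triple A B (\<Phi> C)"
begin

lemma map_zero [simp]: "\<Phi> 0 = 0"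
  using map_triple [of 0 0 0] by (simp add: triple_def skew_def)

end

text \<open>Throughout this locale the identity is evaluated at triples containing \<open>1\<close> or \<open>j\<close>, for which
most of its terms vanish.\<close>

locale additive_mixed_triple_derivation = mixed_triple_derivation +
  assumes additive: "X \<in> M \<Longrightarrow> Y \<in> M \<Longrightarrow> \<Phi> (X + Y) = \<Phi> X + \<Phi> Y"
begin

lemma additive_minus: "X \<in> M \<Longrightarrow> \<Phi> (- X) = - \<Phi> X"
  using additive [of X "- X"] by (simp add: eq_neg_iff_add_eq_0 add.commute)

lemma additive_diff: "X \<in> M \<Longrightarrow> Y \<in> M \<Longrightarrow> \<Phi> (X - Y) = \<Phi> X - \<Phi> Y"
  using additive [of X "- Y"] additive_minus by simp

lemma triple_skew:
  assumes "B \<in> M" "C \<in> M"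
  shows "\<Phi> (skew B C) + \<Phi> (skew B C) = triple (\<Phi> 1) B C
    + (skew (\<Phi> B) C + skew (\<Phi> B) C) + (skew B (\<Phi> C) + skew B (\<Phi> C))"
  using map_triple [of 1 B C] assms by (simp add: triple_one additive)

lemma map_one_self_adjoint: "star (\<Phi> 1) = \<Phi> 1"
proof -
  have "(\<Phi> 1 - star (\<Phi> 1)) + (\<Phi> 1 - star (\<Phi> 1)) = 0"
    using triple_skew [of 1 1] by (simp add: skew_def triple_def)
  then show ?thesis by simp
qed

text \<open>The triples \<open>(X, 1, 1)\<close> and \<open>(A, \<Phi> 1, 1)\<close> have value zero because \<open>1\<close> and \<open>\<Phi> 1\<close> are
self-adjoint; the identity at \<open>(A, 1, 1)\<close> leaves only the commutator of \<open>2 A\<close> with \<open>\<Phi> 1\<close>.\<close>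

lemma map_one_commutes_self_adjoint:
  assumes "A \<in> M" "star A = A"
  shows "\<Phi> 1 * A = A * \<Phi> 1"
proof -
  have "triple A 1 1 = 0" "triple (\<Phi> A) 1 1 = 0" by (simp_all add: triple_def skew_def add.commute)
  moreover have "triple A (\<Phi> 1) 1 = 0" by (simp add: triple_def skew_def map_one_self_adjoint assms add.commute)
  ultimately have "triple A 1 (\<Phi> 1) = 0" using map_triple [of A 1 1] assms by simp
  then have "(A * \<Phi> 1 - \<Phi> 1 * A) + (A * \<Phi> 1 - \<Phi> 1 * A) = 0"
    using assms by (simp add: triple_def skew_def algebra_simps)
  then have "A * \<Phi> 1 - \<Phi> 1 * A = 0" by (simp only: double_eq_0)
  then show ?thesis by simp
qed

lemma map_one_commutes:
  assumes "A \<in> M" shows "\<Phi> 1 * A = A * \<Phi> 1"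
proof -
  obtain X Y where "X \<in> M" "Y \<in> M" "star X = X" "star Y = Y" "A = X + j * Y"
    using assms by (rule real_imaginary_parts)
  then show ?thesis
    using map_one_commutes_self_adjoint [of X] map_one_commutes_self_adjoint [of Y] j_central [of "\<Phi> 1"]
    by (simp add: algebra_simps) (metis mult.assoc)
qed

text \<open>Here \<open>skew B 1 = B - B\<^sup>*\<close> is zero, and the contributions of \<open>\<Phi> 1\<close> cancel because \<open>\<Phi> 1\<close> is
central.\<close>

lemma map_self_adjoint:
  assumes "B \<in> M" "star B = B"
  shows "star (\<Phi> B) = \<Phi> B"
proof -
  have "(\<Phi> B - star (\<Phi> B)) + (\<Phi> B - star (\<Phi> B)) = 0"
    using triple_skew [of B 1] assms map_one_commutes [of B]
    by (simp add: skew_def triple_def map_one_self_adjoint add.commute)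
  then show ?thesis by simp
qed

text \<open>At \<open>(1, j, 1)\<close> the identity says that the self-adjoint element \<open>\<Phi> j + (\<Phi> j)\<^sup>*\<close> equals
\<open>4 j (\<Phi> 1)\<close>, which is skew-adjoint because \<open>\<Phi> 1\<close> is self-adjoint and \<open>j\<close> is central; so both
sides are zero.\<close>

lemma map_one: "\<Phi> 1 = 0" and map_j_skew: "star (\<Phi> j) = - \<Phi> j"
proof -
  let ?h = "\<Phi> 1" and ?g = "\<Phi> j"
  have 1: "triple ?h j 1 = j * ?h + j * ?h + (j * ?h + j * ?h)"
    by (simp add: triple_def skew_def map_one_self_adjoint j_central [of "\<Phi> 1"] algebra_simps)
  have 2: "skew j ?h = j * ?h + j * ?h" by (simp add: skew_def j_central [of ?h])
  have "?g + ?g + (?g + ?g) = j * ?h + j * ?h + (j * ?h + j * ?h) + (?g - star ?g + (?g - star ?g))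
    + (j * ?h + j * ?h + (j * ?h + j * ?h))"
    using triple_skew [of j 1] 1 2 by (simp add: skew_def additive)
  then have "(?g + star ?g) + (?g + star ?g) = (4 *\<^sub>R (j * ?h)) + (4 *\<^sub>R (j * ?h))"
    by (simp add: algebra_simps scaleR_left_distrib [of 2 2, simplified] scaleR_2)
  then have g: "?g + star ?g = 4 *\<^sub>R (j * ?h)" by (rule halve)
  from arg_cong [OF this, of star] have "?g + star ?g = - (4 *\<^sub>R (j * ?h))"
    by (simp add: map_one_self_adjoint j_central [of "\<Phi> 1"] add.commute)
  with g have "j * ?h = 0" by simp
  then show "\<Phi> 1 = 0" by (rule j_cancel)
  with g show "star ?g = - ?g" by (simp add: eq_neg_iff_add_eq_0 add.commute)
qed

lemma map_skew:
  assumes "B \<in> M" "C \<in> M"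
  shows "\<Phi> (skew B C) = skew (\<Phi> B) C + skew B (\<Phi> C)"
  by (rule halve) (use triple_skew [OF assms] in \<open>simp add: map_one triple_def skew_def algebra_simps\<close>)

text \<open>Since \<open>skew j j = -2\<close> is a multiple of \<open>1\<close>, its image vanishes, while the skew product rule
gives \<open>4 j (\<Phi> j)\<close>.\<close>

lemma map_j: "\<Phi> j = 0"
proof -
  have "\<Phi> (skew j j) = 0" by (simp add: skew_def additive additive_diff additive_minus map_one)
  then have "j * \<Phi> j + j * \<Phi> j + (j * \<Phi> j + j * \<Phi> j) = 0"
    by (simp add: map_skew) (simp add: skew_def map_j_skew j_central [of "\<Phi> j"])
  then have "j * \<Phi> j = 0" by simp
  then show ?thesis by (rule j_cancel)
qed

lemma map_j_mult:
  assumes "C \<in> M" shows "\<Phi> (j * C) = j * \<Phi> C"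
proof (rule halve)
  have "skew j X = j * X + j * X" for X by (simp add: skew_def j_central [of X])
  then show "\<Phi> (j * C) + \<Phi> (j * C) = j * \<Phi> C + j * \<Phi> C"
    using map_skew [of j C] assms by (simp add: map_j additive) (simp add: skew_def)
qed

lemma map_star:
  assumes "X \<in> M" shows "\<Phi> (star X) = star (\<Phi> X)"
proof -
  obtain A B where "A \<in> M" "B \<in> M" "star A = A" "star B = B" "X = A + j * B"
    using assms by (rule real_imaginary_parts)
  then show ?thesis
    by (simp add: additive additive_diff map_j_mult j_central [of B] j_central [of "\<Phi> B"] map_self_adjoint)
qed

text \<open>For self-adjoint \<open>B\<close>, \<open>skew B C\<close> is the commutator and \<open>skew (j * B) C\<close> is \<open>j\<close> times the
anticommutator, so \<open>\<Phi>\<close> derives both; their sum is twice the product.\<close>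

lemma map_mult_self_adjoint:
  assumes "B \<in> M" "C \<in> M" "star B = B"
  shows "\<Phi> (B * C) = \<Phi> B * C + B * \<Phi> C"
proof (rule halve)
  note sB = map_self_adjoint [OF assms(1,3)]
  have 1: "\<Phi> (B * C) - \<Phi> (C * B) = \<Phi> B * C - C * \<Phi> B + (B * \<Phi> C - \<Phi> C * B)"
    using map_skew [of B C] assms sB by (simp add: skew_def additive_diff)
  have "\<Phi> (j * (B * C + C * B)) = j * (\<Phi> B * C + C * \<Phi> B + (B * \<Phi> C + \<Phi> C * B))"
    using map_skew [of "j * B" C] assms sB
    by (simp add: skew_times_j map_j_mult distrib_left)
  then have "j * (\<Phi> (B * C) + \<Phi> (C * B) - (\<Phi> B * C + C * \<Phi> B + (B * \<Phi> C + \<Phi> C * B))) = 0"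
    using assms by (simp add: map_j_mult additive right_diff_distrib)
  then have 2: "\<Phi> (B * C) + \<Phi> (C * B) = \<Phi> B * C + C * \<Phi> B + (B * \<Phi> C + \<Phi> C * B)"
    using j_cancel by fastforce
  show "\<Phi> (B * C) + \<Phi> (B * C) = (\<Phi> B * C + B * \<Phi> C) + (\<Phi> B * C + B * \<Phi> C)"
    using arg_cong2 [OF 1 2, of "(+)"] by (simp add: algebra_simps)
qed

lemma map_mult:
  assumes "X \<in> M" "C \<in> M"
  shows "\<Phi> (X * C) = \<Phi> X * C + X * \<Phi> C"
proof -
  obtain A B where "A \<in> M" "B \<in> M" "star A = A" "star B = B" "X = A + j * B"
    using assms(1) by (rule real_imaginary_parts)
  then show ?thesis using assms(2)
    by (simp add: additive map_j_mult map_mult_self_adjoint distrib_right distrib_left mult.assoc add_ac)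
qed

end

section \<open>Additivity from the Peirce decomposition\<close>

context mixed_triple_derivation
begin

text \<open>Additivity is proved one pair of summands at a time, so it is made a property of a pair.\<close>

definition splits :: "'a \<Rightarrow> 'a \<Rightarrow> bool" where
  "splits X Y \<longleftrightarrow> \<Phi> (X + Y) = \<Phi> X + \<Phi> Y"

definition defect :: "'a \<Rightarrow> 'a \<Rightarrow> 'a" where
  "defect X Y = \<Phi> (X + Y) - \<Phi> X - \<Phi> Y"

lemma splits_iff: "splits X Y \<longleftrightarrow> defect X Y = 0"
  by (simp add: splits_def defect_def diff_diff_eq)

lemma splits_sym: "splits X Y \<Longrightarrow> splits Y X"
  by (simp add: splits_def add.commute)

lemma splits_zero [simp]: "splits 0 Y" "splits Y 0"
  by (simp_all add: splits_def)

text \<open>The basic device: the triple identities for \<open>X\<close>, \<open>Y\<close> and \<open>X + Y\<close> have the same first two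
arguments, so their difference is the value of the triple at the defect.  Taking the first two
arguments to be \<open>1\<close> and \<open>B / 2\<close> turns the triple into \<open>skew B\<close>.\<close>

lemma skew_defect:
  assumes "B \<in> M" "X \<in> M" "Y \<in> M" and "splits (skew B X) (skew B Y)"
  shows "skew B (defect X Y) = 0"
proof -
  note t = map_triple [of 1 "(1/2) *\<^sub>R B", unfolded triple_one_half]
  from t[of "X + Y"] t[of X] t[of Y] assms
  show ?thesis
    by (simp add: splits_def defect_def skew_add_right skew_diff_right triple_def)
qed

text \<open>The same device with the summands in the second argument, where \<open>triple 1 X C\<close> is twice
\<open>skew X C\<close>.\<close>

lemma defect_skew:
  assumes "C \<in> M" "X \<in> M" "Y \<in> M"
    and "splits (skew X C + skew X C) (skew Y C + skew Y C)"
  shows "skew (defect X Y) C = 0"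
proof -
  have "triple A (X + Y) C = triple A X C + triple A Y C" for A
    by (simp add: triple_def skew_add_left algebra_simps)
  moreover from this[of 1] this[of "\<Phi> 1"] map_triple [of 1 "X + Y" C] map_triple [of 1 X C] map_triple [of 1 Y C] assms
  have "skew (defect X Y) C + skew (defect X Y) C = 0"
    by (simp add: splits_def defect_def skew_add_left skew_diff_left triple_one algebra_simps)
  ultimately show ?thesis by simp
qed

text \<open>For self-adjoint \<open>H\<close>, \<open>skew (j * H)\<close> is \<open>j\<close> times the anticommutator with \<open>H\<close>.  With
\<open>H\<close> a combination of \<open>P\<close> and \<open>Q\<close> this removes chosen Peirce corners from the defect.\<close>

lemma defect_commutator:
  assumes "H \<in> M" "star H = H" "X \<in> M" "Y \<in> M"
    and "splits (j * (H * X + X * H)) (j * (H * Y + Y * H))"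
  shows "H * defect X Y + defect X Y * H = 0"
  using skew_defect [of "j * H" X Y] assms
  by (simp add: skew_j_self_adjoint j_cancel)

text \<open>The anticommutator with \<open>P - Q\<close> kills off-diagonal elements, hence the diagonal corners
of the defect vanish.  It treats both off-diagonal corners alike; these are separated
in the other slot, where \<open>skew X P = 0\<close> for \<open>X\<close> in the corner \<open>P, Q\<close> and \<open>skew Y Q = 0\<close> for
\<open>Y\<close> in the corner \<open>Q, P\<close>.\<close>

lemma splits_off_diagonal:
  assumes c: "complementary P Q" and X: "X \<in> corner P Q" and Y: "Y \<in> corner Q P"
  shows "splits X Y"
proof -
  note cp = complementaryD [OF c]
  note X = cornerD(2) [OF c X]
  note Y = cornerD(2) [OF complementary_sym [OF c] Y]
  define D where "D = defect X Y"
  have "(P - Q) * D + D * (P - Q) = 0"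
    unfolding D_def using X Y cp by (intro defect_commutator) (simp_all add: algebra_simps)
  then have *: "P * ((P - Q) * D + D * (P - Q)) * P = 0" "Q * ((P - Q) * D + D * (P - Q)) * Q = 0"
    by simp_all
  then have "P * D * P + P * D * P = 0" "Q * D * Q + Q * D * Q = 0"
    by (simp_all add: algebra_simps cp complementary_absorb [OF c])
  then have diag: "P * D * P = 0" "Q * D * Q = 0" by simp_all
  have PX: "P * star X = 0" using X cp by (metis star_mult star_zero)
  have QY: "Q * star Y = 0" using Y cp by (metis star_mult star_zero)
  have "skew D P = 0"
    unfolding D_def using X Y cp PX by (intro defect_skew) (simp_all add: skew_def)
  then have "D * P = P * star D" by (simp add: skew_def cp)
  then have "Q * D * P = 0" using cp by (metis mult.assoc mult_zero_left)
  moreover have "skew D Q = 0"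
    unfolding D_def using X Y cp QY by (intro defect_skew) (simp_all add: skew_def)
  then have "D * Q = Q * star D" by (simp add: skew_def cp)
  then have "P * D * Q = 0" using cp by (metis mult.assoc mult_zero_left)
  ultimately have "D = 0"
    by (subst peirce_decomposition [OF c, of D]) (simp add: diag)
  then show ?thesis by (simp add: splits_iff D_def)
qed

text \<open>\<open>Q\<close> annihilates \<open>X\<close> from both sides and \<open>P - Q\<close> anticommutes with \<open>Y\<close>, so the defect
anticommutes with \<open>Q\<close> and with \<open>P - Q\<close>, hence with \<open>P + Q = 1\<close>.\<close>

lemma splits_corner_off:
  assumes c: "complementary P Q" and X: "X \<in> corner P P" and Y: "Y \<in> off_diagonal P Q"
  shows "splits X Y"
proof -
  note cp = complementaryD [OF c]
  note X = cornerD(1) [OF c X]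
  note Y = Y [unfolded off_diagonal_def]
  define D where "D = defect X Y"
  have "(P - Q) * D + D * (P - Q) = 0"
    unfolding D_def using X Y cp by (intro defect_commutator) (simp_all add: algebra_simps)
  moreover have "Q * D + D * Q = 0"
    unfolding D_def using X Y cp by (intro defect_commutator) (simp_all add: algebra_simps)
  ultimately have "(P + Q) * D + D * (P + Q) = 0" by (simp add: algebra_simps)
  then show ?thesis by (simp add: cp D_def splits_iff)
qed

text \<open>\<open>P\<close> annihilates \<open>Z\<close>.  The anticommutator with \<open>Q\<close> kills \<open>X\<close>, and what it leaves of \<open>Y\<close> and
\<open>Z\<close> is a pair that splits by \<open>splits_corner_off\<close> with the projections exchanged.\<close>

lemma splits_corner_off_corner:
  assumes c: "complementary P Q"
    and X: "X \<in> corner P P" and Y: "Y \<in> off_diagonal P Q" and Z: "Z \<in> corner Q Q"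
  shows "splits (X + Y) Z"
proof -
  note cp = complementaryD [OF c]
  note X' = cornerD(1) [OF c X]
  note Z' = cornerD(1) [OF complementary_sym [OF c] Z]
  note Y' = Y [unfolded off_diagonal_def]
  define D where "D = defect (X + Y) Z"
  have Y1: "Q * Y + Y * Q = Y"
  proof -
    have "Q * Y + Y * Q = Y * (P + Q)" using Y' by (simp add: algebra_simps)
    then show ?thesis by (simp add: cp)
  qed
  have "P * D + D * P = 0"
    unfolding D_def using X' Y' Z' cp by (intro defect_commutator) (simp_all add: algebra_simps)
  moreover have "j * (Z + Z) \<in> corner Q Q" "j * Y \<in> off_diagonal P Q"
    using Z Y cp j_central[of P] j_central[of Q]
    by (auto simp: corner_def off_diagonal_def algebra_simps simp flip: mult.assoc)
      (auto simp: mult.assoc)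
  then have "splits (j * Y) (j * (Z + Z))"
    using splits_corner_off [OF complementary_sym [OF c]] by (metis splits_sym off_diagonal_sym)
  then have "Q * D + D * Q = 0"
    unfolding D_def using X' Y' Z' Y1 cp
    by (intro defect_commutator) (simp_all add: algebra_simps)
  ultimately have "(P + Q) * D + D * (P + Q) = 0" by (simp add: algebra_simps)
  then show ?thesis by (simp add: cp D_def splits_iff)
qed

text \<open>Additivity inside an off-diagonal corner is read off from a product of sums:
\<open>(P + X)(Q + Y) = X + Y\<close>, and \<open>skew (P + X) (Q + Y)\<close> differs from it by terms in other corners.
Since \<open>\<Phi>\<close> is additive on \<open>P + X\<close> and on \<open>Q + Y\<close>, the triple identity expands
bilinearly, and the extra terms are separated by the preceding lemmas.\<close>

lemma splits_corner:
  assumes c: "complementary P Q" and X: "X \<in> corner P Q" and Y: "Y \<in> corner P Q"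
  shows "splits X Y"
proof -
  note cp = complementaryD [OF c]
  note X' = cornerD(2) [OF c X]
  note Y' = cornerD(2) [OF c Y]
  note offX = subsetD [OF corner_off_diagonal(1) [OF c]]
  note offY = subsetD [OF corner_off_diagonal(2) [OF c]]
  have sX: "- star X \<in> corner Q P"
    using corner_star [OF cp(3,4) X] by (auto simp: corner_def)
  note sX' = cornerD(2) [OF complementary_sym [OF c] corner_star [OF cp(3,4) X]]
  have YX: "- (Y * star X) \<in> corner P P"
    using corner_star [OF cp(3,4) X] Y by (auto simp: corner_def mult.assoc) (simp flip: mult.assoc)
  have 1: "\<Phi> ((1/2) *\<^sub>R (P + X)) = \<Phi> ((1/2) *\<^sub>R P) + \<Phi> ((1/2) *\<^sub>R X)"
  proof -
    have "splits ((1/2) *\<^sub>R P) ((1/2) *\<^sub>R X)"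
      using X' cp by (intro splits_corner_off [OF c] offX) (auto simp: corner_def)
    then show ?thesis by (simp add: splits_def scaleR_right_distrib)
  qed
  have 2: "\<Phi> (Q + Y) = \<Phi> Q + \<Phi> Y"
  proof -
    have "splits Q Y"
      using offX [OF Y] cp
      by (intro splits_corner_off [OF complementary_sym [OF c]]) (auto simp: corner_def off_diagonal_sym)
    then show ?thesis by (simp add: splits_def)
  qed
  have XY0: "X * Y = 0" using X' Y' by (metis mult.assoc mult_zero_left)
  have lhs: "skew (P + X) (Q + Y) = - (Y * star X) + ((X + Y) + - star X)"
    using X' Y' sX' cp XY0 by (simp add: skew_def algebra_simps)
  (* The four products into which the skew product expands; the last two supply the
     adjoint terms that also occur in the expression above. *)
  have parts: "skew P Q = 0" "skew P Y = Y" "skew X Q = X + - star X" "skew X Y = - (Y * star X)"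
    using X' Y' sX' cp XY0 by (simp_all add: skew_def)
  note t = map_triple [of 1 "(1/2) *\<^sub>R _", unfolded triple_one_half]
  have "\<Phi> (skew (P + X) (Q + Y)) = \<Phi> (skew P Q) + \<Phi> (skew P Y) + \<Phi> (skew X Q) + \<Phi> (skew X Y)"
    using X' Y' cp t[of "P + X" "Q + Y"] t[of P Q] t[of P Y] t[of X Q] t[of X Y]
    unfolding 1 2
    by (simp add: triple_def skew_add_left skew_add_right algebra_simps scaleR_right_distrib)
  moreover have "splits (- (Y * star X)) ((X + Y) + - star X)"
    using YX by (rule splits_corner_off [OF c])
      (intro off_diagonal_add offX offY sX corner_add X Y)
  moreover have "splits (X + Y) (- star X)" "splits X (- star X)"
    using splits_off_diagonal [OF c] corner_add X Y sX by blast+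
  ultimately show ?thesis
    by (simp add: lhs parts splits_def algebra_simps)
qed

end

locale prime_mixed_triple_derivation = mixed_triple_derivation +
  fixes P :: 'a
  assumes prime: "A \<in> M \<Longrightarrow> B \<in> M \<Longrightarrow> (\<And>Z. Z \<in> M \<Longrightarrow> A * Z * B = 0) \<Longrightarrow> A = 0 \<or> B = 0"
    and P: "P \<in> M" "star P = P" "P * P = P" "P \<noteq> 0" "P \<noteq> 1"
begin

text \<open>The defect lies in the same corner as \<open>X\<close> and \<open>Y\<close>.  Multiplying by \<open>W\<close> in the corner \<open>E, F\<close>
moves \<open>X\<close> and \<open>Y\<close> into that off-diagonal corner, where additivity is known; so \<open>D W = 0\<close> for all
such \<open>W\<close>, that is \<open>D M F = 0\<close>.\<close>

lemma splits_diagonal_corner: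
  assumes c: "complementary E F" and F: "F \<noteq> 0" and X: "X \<in> corner E E" and Y: "Y \<in> corner E E"
  shows "splits X Y"
proof -
  note cp = complementaryD [OF c]
  note X' = cornerD(1) [OF c X]
  note Y' = cornerD(1) [OF c Y]
  define D where "D = defect X Y"
  have DM: "D \<in> M" using X' Y' by (simp add: D_def defect_def)
  have "F * D + D * F = 0"
    unfolding D_def using X' Y' cp by (intro defect_commutator) (simp_all add: algebra_simps)
  then have D: "D \<in> corner E E" by (rule corner_of_anticommutator [OF c DM])
  have "D * Z * F = 0" if Z: "Z \<in> M" for Z
  proof -
    have W: "E * Z * F \<in> corner E F" using corner_sandwich [OF c Z] by simp
    have VW: "V * (E * Z * F) + V * (E * Z * F) \<in> corner E F" if "V \<in> corner E E" for V
      using corner_mult [OF that W] corner_add by blast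
    have "skew D (E * Z * F) = 0"
      unfolding D_def using X' Y' Z cp
      by (intro defect_skew)
        (simp_all add: skew_corner [OF c X W] skew_corner [OF c Y W]
          splits_corner [OF c VW [OF X] VW [OF Y]])
    then have "D * (E * Z * F) = 0" using skew_corner [OF c D W] by simp
    then show ?thesis using cornerD(1) [OF c D] by (metis mult.assoc)
  qed
  then have "D = 0" using prime [of D F] DM F cp by auto
  then show ?thesis by (simp add: splits_iff D_def)
qed

lemma additive_of_prime:
  assumes X: "X \<in> M" and Y: "Y \<in> M"
  shows "\<Phi> (X + Y) = \<Phi> X + \<Phi> Y"
proof -
  define Q where "Q = 1 - P"
  have c: "complementary P Q" using P by (auto simp: complementary_def Q_def)
  have Q0: "Q \<noteq> 0" using P by (simp add: Q_def)
  note c' = complementary_sym [OF c]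
  have decomp: "\<Phi> (A + (B + C) + D) = \<Phi> A + (\<Phi> B + \<Phi> C) + \<Phi> D"
    if "A \<in> corner P P" "B \<in> corner P Q" "C \<in> corner Q P" "D \<in> corner Q Q" for A B C D
  proof -
    have "B + C \<in> off_diagonal P Q"
      using that corner_off_diagonal [OF c] by (intro off_diagonal_add) auto
    then show ?thesis
      using splits_corner_off_corner [OF c that(1) _ that(4)] splits_corner_off [OF c that(1)]
        splits_off_diagonal [OF c that(2,3)]
      by (simp add: splits_def)
  qed
  have 1: "V = P * V * P + (P * V * Q + Q * V * P) + Q * V * Q" for V
    by (rule peirce_decomposition [OF c])
  have 2: "\<Phi> V = \<Phi> (P * V * P) + (\<Phi> (P * V * Q) + \<Phi> (Q * V * P)) + \<Phi> (Q * V * Q)" if "V \<in> M" for V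
    using decomp [OF corner_sandwich [OF c that]] 1 [of V] by simp
  note s = corner_sandwich [OF c X] corner_sandwich [OF c Y]
  have "\<Phi> (X + Y) = \<Phi> (P * X * P + P * Y * P) + (\<Phi> (P * X * Q + P * Y * Q) + \<Phi> (Q * X * P + Q * Y * P))
     + \<Phi> (Q * X * Q + Q * Y * Q)"
    using 2 [of "X + Y"] X Y by (simp add: algebra_simps)
  moreover have "splits (P * X * P) (P * Y * P)" "splits (P * X * Q) (P * Y * Q)"
    "splits (Q * X * P) (Q * Y * P)" "splits (Q * X * Q) (Q * Y * Q)"
    using s splits_diagonal_corner [OF c Q0] splits_diagonal_corner [OF c' P(4)]
      splits_corner [OF c] splits_corner [OF c'] by blast+
  ultimately show ?thesis
    using 2 [OF X] 2 [OF Y] by (simp add: splits_def algebra_simps)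
qed

sublocale additive_mixed_triple_derivation
  by unfold_locales (rule additive_of_prime)

end

section \<open>The algebra of bounded operators\<close>

text \<open>The type \<open>'a \<Rightarrow>\<^sub>L 'a\<close> contains maps that are only real-linear, and its composition is not
an instance of multiplication.  A type of its own for the complex-linear bounded operators makes the
adjoint total and gives access to the ring calculus.\<close>

typedef (overloaded) 'a operator = "bounded_operators :: ('a::chilbert_space \<Rightarrow>\<^sub>L 'a) set"
  morphisms to_blinfun of_blinfun
  by (rule exI [of _ 0]) (simp add: bounded_operators_def)

setup_lifting type_definition_operator

instantiation operator :: (chilbert_space) "{real_algebra, monoid_mult}"
begin

lift_definition zero_operator :: "'a operator" is 0
  by (simp add: bounded_operators_def)
lift_definition one_operator :: "'a operator" is id_blinfun
  by (simp add: bounded_operators_def)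
lift_definition plus_operator :: "'a operator \<Rightarrow> 'a operator \<Rightarrow> 'a operator" is "(+)"
  by (simp add: bounded_operators_def blinfun.add_left scaleC_add_right)
lift_definition minus_operator :: "'a operator \<Rightarrow> 'a operator \<Rightarrow> 'a operator" is "(-)"
  by (simp add: bounded_operators_def blinfun.diff_left complex_vector.scale_right_diff_distrib)
lift_definition uminus_operator :: "'a operator \<Rightarrow> 'a operator" is "uminus"
  by (simp add: bounded_operators_def blinfun.minus_left)
lift_definition times_operator :: "'a operator \<Rightarrow> 'a operator \<Rightarrow> 'a operator" is "(o\<^sub>L)"
  by (simp add: bounded_operators_def)
lift_definition scaleR_operator :: "real \<Rightarrow> 'a operator \<Rightarrow> 'a operator" is "(*\<^sub>R)"
  by (simp add: bounded_operators_def scaleR_scaleC scaleC_blinfun.rep_eq mult.commute)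

instance
  by standard
    (transfer; rule blinfun_eqI; simp add: blinfun.bilinear_simps algebra_simps)+

end

lift_definition app :: "'a::chilbert_space operator \<Rightarrow> 'a \<Rightarrow> 'a" is blinfun_apply .

lift_definition imaginary_operator :: "'a::chilbert_space operator" is "\<i> *\<^sub>C id_blinfun"
  by (simp add: bounded_operators_def scaleC_blinfun.rep_eq mult.commute)

lift_definition adj :: "'a::chilbert_space operator \<Rightarrow> 'a operator" is cadjoint
proof -
  fix A :: "'a \<Rightarrow>\<^sub>L 'a" assume A: "A \<in> bounded_operators"
  have "inner x (cadjoint A (c *\<^sub>C y)) = inner x (c *\<^sub>C cadjoint A y)" for x y c
    by (simp add: inner_eq_Re_cinner flip: cinner_cadjoint [OF A])
      (simp add: cinner_scaleC_right cinner_cadjoint [OF A])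
  then show "cadjoint A \<in> bounded_operators"
    unfolding bounded_operators_def by (auto intro: vector_eq_ldot [THEN iffD1, OF allI])
qed

lemma operator_eqI: "(\<And>x. app S x = app T x) \<Longrightarrow> S = T"
  by transfer (rule blinfun_eqI)

lemma app_simps [simp]:
  "app 0 x = 0" "app 1 x = x" "app (S + T) x = app S x + app T x" "app (S - T) x = app S x - app T x"
  "app (- T) x = - app T x" "app (S * T) x = app S (app T x)" "app (r *\<^sub>R T) x = r *\<^sub>R app T x"
  "app imaginary_operator x = \<i> *\<^sub>C x"
  by (transfer; simp add: blinfun.bilinear_simps scaleC_blinfun.rep_eq)+

lemma app_scaleC: "app T (c *\<^sub>C x) = c *\<^sub>C app T x"
  by transfer (simp add: bounded_operators_def)

lemma bounded_linear_app: "bounded_linear (app T)"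
  by transfer (rule blinfun.bounded_linear_right)

lemmas app_linear [simp] =
  bounded_linear_app [THEN bounded_linear.linear, THEN linear_add]
  bounded_linear_app [THEN bounded_linear.linear, THEN linear_diff]
  bounded_linear_app [THEN bounded_linear.linear, THEN linear_0]
  bounded_linear_app [THEN bounded_linear.linear, THEN linear_neg]
  bounded_linear_app [THEN bounded_linear.linear, THEN linear_scale]

lemma cinner_adj: "cinner (app T x) y = cinner x (app (adj T) y)"
  by transfer (rule cinner_cadjoint)

text \<open>The real inner product determines adjoints and positivity, and it is the one used from here
on.\<close>

lemma inner_adj: "inner (app T x) y = inner x (app (adj T) y)"
  by (simp add: inner_eq_Re_cinner cinner_adj)

lemma adj_unique:
  assumes "\<And>x y. inner (app T x) y = inner x (app S y)" shows "adj T = S"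
proof (rule operator_eqI)
  fix y
  have "inner x (app (adj T) y) = inner x (app S y)" for x
    using assms by (simp flip: inner_adj)
  then show "app (adj T) y = app S y" by (rule vector_eq_ldot [THEN iffD1, OF allI])
qed

lemma inner_adj_left: "inner (app (adj T) x) y = inner x (app T y)"
  by (metis inner_adj inner_commute)

lemma adj_adj [simp]: "adj (adj T) = T"
  by (rule adj_unique) (rule inner_adj_left)

lemma adj_simps [simp]:
  "adj (S + T) = adj S + adj T" "adj (S - T) = adj S - adj T"
  "adj (S * T) = adj T * adj S" "adj (r *\<^sub>R T) = r *\<^sub>R adj T" "adj 1 = 1" "adj 0 = 0"
  by (rule adj_unique; simp add: inner_adj inner_add_left inner_add_right inner_diff_left inner_diff_right)+

lemma adj_imaginary_operator [simp]: "adj imaginary_operator = - imaginary_operator"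
proof (rule adj_unique)
  fix x y :: 'a
  have "inner (\<i> *\<^sub>C x) y = inner x ((- \<i>) *\<^sub>C y)"
    by (simp only: inner_eq_Re_cinner cinner_scaleC_left cinner_scaleC_right) simp
  then show "inner (app imaginary_operator x) y = inner x (app (- imaginary_operator) y)" by simp
qed

lemma imaginary_operator_square: "imaginary_operator * imaginary_operator = - 1"
  by (rule operator_eqI) simp

lemma imaginary_operator_central: "T * imaginary_operator = imaginary_operator * T"
  by (rule operator_eqI) (simp add: app_scaleC)

lemma app_bound:
  obtains K where "K > 0" "\<And>x. norm (app T x) \<le> K * norm x"
  using bounded_linear.pos_bounded [OF bounded_linear_app [of T]] by (metis mult.commute)

lemma self_adjoint_inner: "adj A = A \<Longrightarrow> inner (app A x) y = inner x (app A y)"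
  by (metis inner_adj)

definition is_positive :: "'a::chilbert_space operator \<Rightarrow> bool" where
  "is_positive T \<longleftrightarrow> adj T = T \<and> (\<forall>x. 0 \<le> inner (app T x) x)"

lemma positive_adj: "is_positive T \<Longrightarrow> adj T = T"
  by (simp add: is_positive_def)

lemma positive_add: "is_positive S \<Longrightarrow> is_positive T \<Longrightarrow> is_positive (S + T)"
  by (simp add: is_positive_def inner_add_left)

lemma positive_scaleR: "is_positive T \<Longrightarrow> 0 \<le> r \<Longrightarrow> is_positive (r *\<^sub>R T)"
  by (simp add: is_positive_def)

lemma positive_sandwich: "is_positive T \<Longrightarrow> adj C = C \<Longrightarrow> is_positive (C * T * C)"
  by (simp add: is_positive_def self_adjoint_inner [of C] mult.assoc)

lemma positive_square: "adj A = A \<Longrightarrow> is_positive (A * A)"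
  by (simp add: is_positive_def self_adjoint_inner [of A "app A x" x for x])

lemma norm_app_square:
  "adj A = A \<Longrightarrow> (norm (app A x))\<^sup>2 = inner (app (A * A) x) x"
  by (simp add: power2_norm_eq_inner self_adjoint_inner [of A "app A x" x])

text \<open>Polarisation of the quadratic form at \<open>x + T x\<close>.\<close>

lemma self_adjoint_eq_0:
  assumes "adj T = T" and "\<And>x. inner (app T x) x = 0"
  shows "T = 0"
proof (rule operator_eqI)
  fix x
  have "inner (app T (x + app T x)) (x + app T x) = 0" by (rule assms)
  then have "inner (app T x) (app T x) + inner (app T (app T x)) x = 0"
    using assms(2) [of x] assms(2) [of "app T x"] by (simp add: inner_add_left inner_add_right)
  then show "app T x = app 0 x"
    by (simp add: inner_adj [of T "app T x" x] assms(1))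
qed

lemma mult_adj_eq_0: "X * adj X = 0 \<Longrightarrow> X = 0"
proof -
  assume *: "X * adj X = 0"
  have "app (adj X) x = 0" for x
    using arg_cong [OF *, of "\<lambda>T. inner (app T x) x"] by (simp add: inner_adj [of X "app (adj X) x"])
  then have "adj X = 0" by (intro operator_eqI) simp
  then show "X = 0" by (metis adj_adj adj_simps(6))
qed

text \<open>Scale \<open>A\<close> to \<open>0 \<le> A \<le> 1\<close> and put \<open>b\<^sub>0 = A\<close>, \<open>b\<^sub>n\<^sub>+\<^sub>1 = b\<^sub>n - b\<^sub>n\<^sup>2\<close>.  Then \<open>A\<close> is the strong
sum of the squares \<open>b\<^sub>n\<^sup>2\<close>, so \<open>A B\<close> is the strong sum of the positive operators \<open>b\<^sub>n B b\<^sub>n\<close>.  This avoids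
square roots.\<close>

lemma positive_mult_commuting:
  assumes A: "is_positive A" and B: "is_positive B" and comm: "A * B = B * A"
  shows "is_positive (A * B)"
proof -
  obtain K where K: "K > 0" "\<And>x. norm (app A x) \<le> K * norm x" using app_bound [of A] by blast
  obtain L where L: "L > 0" "\<And>x. norm (app B x) \<le> L * norm x" using app_bound [of B] by blast
  define b where "b n = ((\<lambda>X. X - X * X) ^^ n) ((1 / K) *\<^sub>R A)" for n
  have b_Suc: "b (Suc n) = b n - b n * b n" for n by (simp add: b_def)
  have b: "is_positive (b n) \<and> is_positive (1 - b n) \<and> b n * B = B * b n" for n
  proof (induction n)
    case 0
    have "inner (app A x) x \<le> K * inner x x" for x
    proof -
      have "inner (app A x) x \<le> norm (app A x) * norm x" by (rule norm_cauchy_schwarz)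
      also have "\<dots> \<le> (K * norm x) * norm x" by (intro mult_right_mono K) simp
      finally show ?thesis by (simp add: power2_norm_eq_inner [symmetric] power2_eq_square)
    qed
    then have "is_positive (1 - b 0)"
      using A K(1) by (simp add: b_def is_positive_def inner_diff_left field_simps)
    then show ?case
      using A K(1) comm by (simp add: b_def positive_scaleR)
  next
    case (Suc n)
    let ?b = "b n"
    have adj: "adj ?b = ?b" "adj (1 - ?b) = 1 - ?b" using Suc by (simp_all add: is_positive_def)
    have "b (Suc n) = ?b * (1 - ?b) * ?b + (1 - ?b) * ?b * (1 - ?b)"
      by (simp add: b_Suc algebra_simps)
    then have "is_positive (b (Suc n))"
      using Suc adj by (simp add: positive_add positive_sandwich)
    moreover have "1 - b (Suc n) = (1 - ?b) + ?b * ?b" by (simp add: b_Suc)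
    then have "is_positive (1 - b (Suc n))"
      using Suc adj by (simp only: positive_add positive_square)
    moreover have "b (Suc n) * B = B * b (Suc n)"
      using Suc by (simp add: b_Suc algebra_simps) (metis mult.assoc)
    ultimately show ?case by blast
  qed
  have nonneg: "0 \<le> inner (app B (app (b 0) x)) x" for x
  proof -
    define g where "g n = inner (app (b n) x) x" for n
    (* The quadratic forms of \<open>b\<^sub>n\<close> decrease with increments \<open>\<parallel>b\<^sub>n x\<parallel>\<^sup>2\<close>, hence \<open>b\<^sub>n x\<close> tends
       to zero. *)
    have gap: "g n - g (Suc n) = (norm (app (b n) x))\<^sup>2" for n
      using b [of n] by (simp add: g_def b_Suc norm_app_square positive_adj inner_diff_left)
    have "decseq g" unfolding decseq_Suc_iff
    proof
      fix n show "g (Suc n) \<le> g n" using gap [of n] zero_le_power2 [of "norm (app (b n) x)"] by linarith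
    qed
    moreover have "0 \<le> g n" for n using b [of n] by (simp add: g_def is_positive_def)
    ultimately obtain l where l: "g \<longlonglongrightarrow> l" using decseq_convergent by blast
    then have "(\<lambda>n. g n - g (Suc n)) \<longlonglongrightarrow> l - l" by (intro tendsto_diff LIMSEQ_Suc)
    then have "(\<lambda>n. (norm (app (b n) x))\<^sup>2) \<longlonglongrightarrow> 0" by (simp add: gap)
    then have "(\<lambda>n. sqrt ((norm (app (b n) x))\<^sup>2)) \<longlonglongrightarrow> sqrt 0" by (rule tendsto_real_sqrt)
    then have lim: "(\<lambda>n. norm (app (b n) x)) \<longlonglongrightarrow> 0" by simp
    define f where "f n = inner (app B (app (b n) x)) x" for n
    have f_Suc: "f (Suc n) \<le> f n" for n
    proof -
      have "f n - f (Suc n) = inner (app (B * b n * b n) x) x"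
        by (simp add: f_def b_Suc inner_diff_left)
      also have "\<dots> = inner (app (b n * B * b n) x) x" using b [of n] by simp
      also have "\<dots> \<ge> 0"
        using positive_sandwich [OF B, of "b n"] b [of n] unfolding is_positive_def by blast
      finally show ?thesis by simp
    qed
    have f_le: "f n \<le> f 0" for n
      by (induction n) (use f_Suc order_trans in blast)+
    have "- (L * norm (app (b n) x) * norm x) \<le> f n" for n
    proof -
      have "\<bar>f n\<bar> \<le> norm (app B (app (b n) x)) * norm x"
        unfolding f_def by (rule Cauchy_Schwarz_ineq2)
      also have "\<dots> \<le> L * norm (app (b n) x) * norm x" by (intro mult_right_mono L) simp
      finally show ?thesis by simp
    qed
    then have "- (L * norm (app (b n) x) * norm x) \<le> f 0" for n using f_le order_trans by blast
    moreover have "(\<lambda>n. - (L * norm (app (b n) x) * norm x)) \<longlonglongrightarrow> - (L * 0 * norm x)"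
      by (intro tendsto_intros lim)
    ultimately have "- (L * 0 * norm x) \<le> f 0" by (intro LIMSEQ_le_const2) auto
    then show ?thesis by (simp add: f_def)
  qed
  have "B * A = K *\<^sub>R (B * b 0)" using K(1) by (simp add: b_def)
  then have "0 \<le> inner (app (A * B) x) x" for x
    unfolding comm using nonneg [of x] K(1) by simp
  moreover have "adj (A * B) = A * B" using A B comm by (simp add: positive_adj)
  ultimately show ?thesis by (simp add: is_positive_def)
qed

section \<open>Strong limits and the sign of a self-adjoint operator\<close>

text \<open>Nets are handled through the filter generated by the tails of a directed set, which covers
sequences and increasing families of projections at the same time.\<close>

definition directed_on :: "'i set \<Rightarrow> ('i \<Rightarrow> 'i \<Rightarrow> bool) \<Rightarrow> bool" where
  "directed_on D R \<longleftrightarrow> D \<noteq> {} \<and> (\<forall>i\<in>D. R i i) \<and>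
     (\<forall>i\<in>D. \<forall>k\<in>D. \<forall>l\<in>D. R i k \<longrightarrow> R k l \<longrightarrow> R i l) \<and> (\<forall>i\<in>D. \<forall>k\<in>D. \<exists>l\<in>D. R i l \<and> R k l)"

definition tail_filter :: "'i set \<Rightarrow> ('i \<Rightarrow> 'i \<Rightarrow> bool) \<Rightarrow> 'i filter" where
  "tail_filter D R = (INF i\<in>D. principal {k \<in> D. R i k})"

lemma eventually_tail_filter:
  "i \<in> D \<Longrightarrow> eventually (\<lambda>k. k \<in> D \<and> R i k) (tail_filter D R)"
  unfolding tail_filter_def by (intro eventually_INF1 [of i]) (auto simp: eventually_principal)

lemma tail_filter_not_bot:
  assumes "directed_on D R" shows "tail_filter D R \<noteq> bot"
proof
  assume "tail_filter D R = bot"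
  then have "eventually (\<lambda>_. False) (INF i\<in>D. principal {k \<in> D. R i k})"
    by (simp add: tail_filter_def)
  then have "\<exists>i\<in>D. eventually (\<lambda>_. False) (principal {k \<in> D. R i k})"
  proof (subst (asm) eventually_INF_base)
    fix a b assume ab: "a \<in> D" "b \<in> D"
    then obtain c where c: "c \<in> D" "R a c" "R b c" using assms unfolding directed_on_def by metis
    have "R a k \<and> R b k" if "k \<in> D" "R c k" for k
      using assms ab c that unfolding directed_on_def by metis
    then show "\<exists>x\<in>D. principal {k \<in> D. R x k} \<le> inf (principal {k \<in> D. R a k}) (principal {k \<in> D. R b k})"
      using c(1) by (intro bexI [of _ c]) auto
  qed (use assms in \<open>auto simp: directed_on_def\<close>)
  then obtain i where i: "i \<in> D" "\<forall>k. k \<in> D \<longrightarrow> \<not> R i k" by (auto simp: eventually_principal)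
  moreover have "R i i" using assms i(1) by (simp add: directed_on_def)
  ultimately show False by blast
qed

lemma sequentially_eq_tail_filter: "sequentially = tail_filter UNIV (\<le>)"
  by (simp add: tail_filter_def at_top_def atLeast_def)

text \<open>Monotone convergence in the form in which it is used below: \<open>\<psi>\<close> is increasing and bounded,
so it is almost constant on some tail, and there \<open>\<phi>\<close> varies little.\<close>

lemma convergent_along_directed_set:
  fixes \<phi> :: "'i \<Rightarrow> 'a::{real_normed_vector, complete_space}" and \<psi> :: "'i \<Rightarrow> real"
  assumes D: "directed_on D R"
    and bound: "\<And>i. i \<in> D \<Longrightarrow> \<psi> i \<le> c"
    and gap: "\<And>i k. i \<in> D \<Longrightarrow> k \<in> D \<Longrightarrow> R i k \<Longrightarrow> (norm (\<phi> k - \<phi> i))\<^sup>2 \<le> \<psi> k - \<psi> i"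
  shows "\<exists>l. (\<phi> \<longlongrightarrow> l) (tail_filter D R)"
proof -
  let ?F = "tail_filter D R"
  have bdd: "bdd_above (\<psi> ` D)" using bound by (auto simp: bdd_above_def)
  have ne: "\<psi> ` D \<noteq> {}" using D by (simp add: directed_on_def)
  have "cauchy_filter (filtermap \<phi> ?F)"
    unfolding cauchy_filter_metric_filtermap
  proof (intro allI impI)
    fix e :: real assume "0 < e"
    then have "Sup (\<psi> ` D) - (e / 2)\<^sup>2 < Sup (\<psi> ` D)" by simp
    then obtain i where i: "i \<in> D" "Sup (\<psi> ` D) - (e / 2)\<^sup>2 < \<psi> i"
      using less_cSup_iff [OF ne bdd] by blast
    have near: "dist (\<phi> k) (\<phi> i) < e / 2" if "k \<in> D" "R i k" for k
    proof -
      have "\<psi> k \<le> Sup (\<psi> ` D)" using that bdd by (intro cSup_upper) auto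
      then have "(norm (\<phi> k - \<phi> i))\<^sup>2 < (e / 2)\<^sup>2" using gap [OF i(1) that] i(2) by linarith
      then show ?thesis
        using \<open>0 < e\<close> power2_less_imp_less [of "norm (\<phi> k - \<phi> i)" "e / 2"] by (simp add: dist_norm)
    qed
    have "dist (\<phi> k) (\<phi> l) < e" if "k \<in> D \<and> R i k" "l \<in> D \<and> R i l" for k l
      using near [of k] near [of l] that dist_triangle2 [of "\<phi> k" "\<phi> l" "\<phi> i"] by linarith
    then show "\<exists>P. eventually P ?F \<and> (\<forall>k l. P k \<and> P l \<longrightarrow> dist (\<phi> k) (\<phi> l) < e)"
      using eventually_tail_filter [OF i(1)] by blast
  qed
  moreover have "filtermap \<phi> ?F \<noteq> bot"
    using tail_filter_not_bot [OF D] by (simp add: filtermap_bot_iff)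
  ultimately obtain l where "filtermap \<phi> ?F \<le> nhds l"
    using cauchy_filter_complete_converges [OF _ complete_UNIV] by (metis principal_UNIV top_greatest)
  then show ?thesis unfolding filterlim_def by blast
qed

definition tends_strongly :: "('i \<Rightarrow> 'a::chilbert_space operator) \<Rightarrow> 'a operator \<Rightarrow> 'i filter \<Rightarrow> bool" where
  "tends_strongly f S F \<longleftrightarrow> (\<forall>x. ((\<lambda>i. app (f i) x) \<longlongrightarrow> app S x) F)"

text \<open>The pointwise limits inherit linearity, and the common bound makes the limit bounded.\<close>

lemma tends_strongly_exists:
  fixes f :: "'i \<Rightarrow> 'a::chilbert_space operator"
  assumes "F \<noteq> bot" and conv: "\<And>x. \<exists>l. ((\<lambda>i. app (f i) x) \<longlongrightarrow> l) F"
    and contr: "eventually (\<lambda>i. \<forall>x. norm (app (f i) x) \<le> norm x) F"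
  obtains S where "tends_strongly f S F"
proof -
  obtain g where g: "\<And>x. ((\<lambda>i. app (f i) x) \<longlongrightarrow> g x) F" using conv by metis
  note uniq = tendsto_unique [OF \<open>F \<noteq> bot\<close> g]
  have scale: "g (c *\<^sub>C x) = c *\<^sub>C g x" for c x
    by (rule uniq) (simp add: app_scaleC bounded_linear.tendsto [OF bounded_linear_scaleC g])
  have "bounded_linear g"
  proof (rule bounded_linear_intro [where K = 1])
    show "g (x + y) = g x + g y" for x y
      by (rule uniq) (simp add: tendsto_add g)
    show "g (r *\<^sub>R x) = r *\<^sub>R g x" for r x
      by (rule uniq) (simp add: tendsto_scaleR g)
    show "norm (g x) \<le> norm x * 1" for x
    proof (rule tendsto_upperbound [OF tendsto_norm [OF g [of x]] _ \<open>F \<noteq> bot\<close>])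
      show "\<forall>\<^sub>F i in F. norm (app (f i) x) \<le> norm x * 1"
        using contr by (rule eventually_mono) simp
    qed
  qed
  then have apply_g: "blinfun_apply (Blinfun g) = g" by (rule bounded_linear_Blinfun_apply)
  then have "Blinfun g \<in> bounded_operators" by (simp add: bounded_operators_def scale)
  then have "app (of_blinfun (Blinfun g)) = g"
    by (simp add: app.rep_eq of_blinfun_inverse apply_g)
  then have "tends_strongly f (of_blinfun (Blinfun g)) F" using g by (simp add: tends_strongly_def)
  then show thesis by (rule that)
qed

lemma tends_strongly_self_adjoint:
  assumes "tends_strongly f S F" "F \<noteq> bot" "eventually (\<lambda>i. adj (f i) = f i) F"
  shows "adj S = S"
proof (rule adj_unique)
  fix x y
  have 1: "((\<lambda>i. inner (app (f i) x) y) \<longlongrightarrow> inner (app S x) y) F"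
    using assms(1) by (intro tendsto_inner tendsto_const) (simp add: tends_strongly_def)
  have 2: "((\<lambda>i. inner x (app (f i) y)) \<longlongrightarrow> inner x (app S y)) F"
    using assms(1) by (intro tendsto_inner tendsto_const) (simp add: tends_strongly_def)
  have "eventually (\<lambda>i. inner (app (f i) x) y = inner x (app (f i) y)) F"
    using assms(3) by (rule eventually_mono) (rule self_adjoint_inner)
  from Lim_transform_eventually [OF 1 this] show "inner (app S x) y = inner x (app S y)"
    using 2 by (rule tendsto_unique [OF assms(2)])
qed

lemma tends_strongly_mult_left:
  assumes "tends_strongly f S F"
  shows "tends_strongly (\<lambda>i. C * f i) (C * S) F"
  using assms bounded_linear.tendsto [OF bounded_linear_app] by (fastforce simp: tends_strongly_def)

lemma tends_strongly_mult_right: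
  assumes "tends_strongly f S F"
  shows "tends_strongly (\<lambda>i. f i * C) (S * C) F"
  using assms by (simp add: tends_strongly_def)

lemma tends_strongly_unique:
  assumes "F \<noteq> bot" "tends_strongly f S F" "tends_strongly g T F" "eventually (\<lambda>i. f i = g i) F"
  shows "S = T"
proof (rule operator_eqI)
  fix x
  have "eventually (\<lambda>i. app (f i) x = app (g i) x) F"
    using assms(4) by (rule eventually_mono) simp
  with assms(2) have "((\<lambda>i. app (g i) x) \<longlongrightarrow> app S x) F"
    unfolding tends_strongly_def by (blast intro: Lim_transform_eventually)
  moreover have "((\<lambda>i. app (g i) x) \<longlongrightarrow> app T x) F"
    using assms(3) by (simp add: tends_strongly_def)
  ultimately show "app S x = app T x" by (rule tendsto_unique [OF assms(1)])
qed

lemma tends_strongly_const: "tends_strongly (\<lambda>_. S) S F"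
  by (simp add: tends_strongly_def)

text \<open>Closure is required along arbitrary filters rather than sequences, since the central projection
found below is the limit of a net.\<close>

locale strongly_closed_star_algebra =
  fixes N :: "'a::chilbert_space operator set"
  assumes add_closed [intro, simp]: "S \<in> N \<Longrightarrow> T \<in> N \<Longrightarrow> S + T \<in> N"
    and mult_closed [intro, simp]: "S \<in> N \<Longrightarrow> T \<in> N \<Longrightarrow> S * T \<in> N"
    and scaleR_closed [intro, simp]: "S \<in> N \<Longrightarrow> r *\<^sub>R S \<in> N"
    and adj_closed [intro, simp]: "S \<in> N \<Longrightarrow> adj S \<in> N"
    and one_closed [intro, simp]: "1 \<in> N"
    and imaginary_operator_closed [intro, simp]: "imaginary_operator \<in> N"
    and strong_limit: "F \<noteq> bot \<Longrightarrow> eventually (\<lambda>T. T \<in> N) F \<Longrightarrow> tends_strongly (\<lambda>T. T) S F \<Longrightarrow> S \<in> N"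
begin

lemma diff_closed [intro, simp]: "S \<in> N \<Longrightarrow> T \<in> N \<Longrightarrow> S - T \<in> N"
  using add_closed [of S "(-1) *\<^sub>R T"] scaleR_closed [of T "-1"] by simp

lemma strong_limit_sequence:
  assumes "\<And>n. f n \<in> N" "tends_strongly f S sequentially"
  shows "S \<in> N"
  using strong_limit [of "filtermap f sequentially" S] assms
  by (simp add: tends_strongly_def filtermap_bot_iff eventually_filtermap filterlim_filtermap)

text \<open>In the spectral picture \<open>S\<close> is the sign function of \<open>A\<close>, with value \<open>0\<close> at \<open>0\<close>.  The last
conjunct expresses that the range of \<open>S\<close> lies in the closed range of \<open>A\<close>.\<close>

definition sign_of :: "'a operator \<Rightarrow> 'a operator \<Rightarrow> bool" where
  "sign_of A S \<longleftrightarrow> S \<in> N \<and> adj S = S \<and> S * S * S = S \<and> A * (S * S) = A \<and> is_positive (A * S) \<and>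
     (\<forall>C. C * A = 0 \<longrightarrow> C * S = 0)"

text \<open>The iteration \<open>t \<mapsto> t(3 - t\<^sup>2)/2\<close> fixes \<open>-1\<close>, \<open>0\<close>, \<open>1\<close> and moves every other point of
\<open>[-1, 1]\<close> towards its sign.  Writing \<open>W = (1 - T\<^sup>2)/2\<close> the step is \<open>T \<mapsto> T(1 + W)\<close>, and \<open>W\<close> stays
positive because it is itself mapped to \<open>3/2 W\<^sup>2 + W\<^sup>3\<close>.  Since all iterates commute, the
products \<open>a\<^sub>n a\<^sub>m\<close> are positive and increase with \<open>m \<ge> n\<close>, which gives the Cauchy estimate
\<open>\<parallel>a\<^sub>m x - a\<^sub>n x\<parallel>\<^sup>2 \<le> \<parallel>a\<^sub>m x\<parallel>\<^sup>2 - \<parallel>a\<^sub>n x\<parallel>\<^sup>2\<close>.\<close>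

lemma contraction_sign:
  assumes A: "A \<in> N" "adj A = A" "is_positive (1 - A * A)"
  shows "\<exists>S. sign_of A S"
proof -
  define W where "W T = (1/2) *\<^sub>R (1 - T * T)" for T :: "'a operator"
  define a where "a n = ((\<lambda>T. T * (1 + W T)) ^^ n) A" for n
  have a_0: "a 0 = A" and a_Suc: "a (Suc n) = a n + a n * W (a n)" for n
    by (simp_all add: a_def distrib_left)
  have W_sum: "W T + W T = 1 - T * T" for T
    by (simp add: W_def flip: scaleR_left_distrib)
  have W_comm: "C * W T = W T * C" if "C * T = T * C" for C T
  proof -
    have "C * (T * T) = T * T * C" by (metis that mult.assoc)
    then show ?thesis by (simp add: W_def algebra_simps)
  qed
  have a_comm: "C * a n = a n * C" if "C * A = A * C" for C n
  proof (induction n)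
    case (Suc n)
    have "C * (a n * W (a n)) = a n * W (a n) * C"
      using Suc W_comm [OF Suc] by (metis mult.assoc)
    then show ?case using Suc by (simp add: a_Suc algebra_simps)
  qed (simp add: a_0 that)
  have a_a: "a m * a n = a n * a m" for m n
    by (rule a_comm) (rule a_comm [of A, symmetric], simp)
  have a_W: "a m * W (a n) = W (a n) * a m" for m n
    by (rule W_comm) (rule a_a)
  have a: "adj (a n) = a n \<and> is_positive (W (a n))" for n
  proof (induction n)
    case 0
    then show ?case using A by (simp add: a_0 W_def positive_scaleR)
  next
    case (Suc n)
    let ?a = "a n" and ?W = "W (a n)"
    have adjs: "adj ?a = ?a" "adj ?W = ?W" using Suc by (simp_all add: is_positive_def)
    have "adj (a (Suc n)) = a (Suc n)" by (simp add: a_Suc adjs a_W)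
    moreover have "is_positive (W (a (Suc n)))"
    proof -
      have "a (Suc n) * a (Suc n) = ?a * ((1 + ?W) * ?a) * (1 + ?W)"
        by (simp add: a_Suc algebra_simps)
      also have "(1 + ?W) * ?a = ?a * (1 + ?W)" by (simp add: a_W algebra_simps)
      also have "?a * (?a * (1 + ?W)) * (1 + ?W) = ?a * ?a * ((1 + ?W) * (1 + ?W))"
        by (simp add: mult.assoc)
      also have "?a * ?a = 1 - ?W - ?W" using W_sum [of ?a] by (simp add: algebra_simps)
      finally have "W (a (Suc n)) + W (a (Suc n)) = (3 *\<^sub>R (?W * ?W)) + 2 *\<^sub>R (?W * ?W * ?W)"
        unfolding W_sum by (simp add: algebra_simps scaleR_2 scaleR_left_distrib [of 2 1, simplified])
      then have "2 *\<^sub>R W (a (Suc n)) = 2 *\<^sub>R ((3/2) *\<^sub>R (?W * ?W) + ?W * ?W * ?W)"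
        by (simp add: scaleR_2 [of "W _"] scaleR_right_distrib)
      then have "W (a (Suc n)) = (3/2) *\<^sub>R (?W * ?W) + ?W * ?W * ?W"
        by (simp only: scaleR_cancel_left) simp
      moreover have "is_positive ((3/2) *\<^sub>R (?W * ?W) + ?W * ?W * ?W)"
        using Suc adjs by (intro positive_add positive_scaleR positive_square positive_sandwich) auto
      ultimately show ?thesis by simp
    qed
    ultimately show ?case by blast
  qed
  have contr: "norm (app (a n) x) \<le> norm x" for n x
  proof -
    have "0 \<le> inner (app (W (a n)) x) x" using a [of n] by (simp add: is_positive_def)
    then have "(norm (app (a n) x))\<^sup>2 \<le> (norm x)\<^sup>2"
      using norm_app_square [of "a n" x] a [of n]
      by (simp add: W_def inner_diff_left power2_norm_eq_inner)
    then show ?thesis by (rule power2_le_imp_le) simp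
  qed
  have prod: "is_positive (a n * a (n + k)) \<and> is_positive (a n * a (n + k) - a n * a n)" for n k
  proof (induction k)
    case 0
    have "is_positive (a n * a n)" using a [of n] by (intro positive_square) simp
    then show ?case by (simp add: is_positive_def [of 0])
  next
    case (Suc k)
    have "a n * a (n + k) * W (a (n + k)) = W (a (n + k)) * (a n * a (n + k))"
      using a_W by (metis mult.assoc)
    then have "is_positive (a n * a (n + k) * W (a (n + k)))"
      using Suc a by (intro positive_mult_commuting [of "a n * a (n + k)"]) auto
    moreover have "a n * a (n + Suc k) = a n * a (n + k) + a n * a (n + k) * W (a (n + k))"
      by (simp add: a_Suc algebra_simps)
    moreover have "a n * a (n + Suc k) - a n * a n = (a n * a (n + k) - a n * a n) + a n * a (n + k) * W (a (n + k))"
      by (simp add: a_Suc algebra_simps)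
    ultimately show ?case using Suc by (metis positive_add)
  qed
  have prod_le: "inner (app (a n * a n) x) x \<le> inner (app (a n * a m) x) x" if "n \<le> m" for n m x
    using prod [of n "m - n"] that by (simp add: is_positive_def inner_diff_left)
  have gap: "(norm (app (a m) x - app (a n) x))\<^sup>2 \<le> (norm (app (a m) x))\<^sup>2 - (norm (app (a n) x))\<^sup>2"
    if "n \<le> m" for n m x
  proof -
    have "inner (app (a n) x) (app (a n) x) \<le> inner (app (a m) x) (app (a n) x)"
      using prod_le [OF that, of x] a [of n] self_adjoint_inner [of "a n"] by simp
    then show ?thesis
      by (simp add: power2_norm_eq_inner inner_diff_left inner_diff_right inner_commute)
  qed
  have "\<exists>l. ((\<lambda>n. app (a n) x) \<longlongrightarrow> l) sequentially" for x
    unfolding sequentially_eq_tail_filter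
  proof (rule convergent_along_directed_set [where \<psi> = "\<lambda>n. (norm (app (a n) x))\<^sup>2" and c = "(norm x)\<^sup>2"])
    show "directed_on UNIV ((\<le>) :: nat \<Rightarrow> nat \<Rightarrow> bool)"
      unfolding directed_on_def by (auto intro: max.cobounded1 max.cobounded2)
  qed (auto intro: gap power_mono contr)
  then obtain S where S: "tends_strongly a S sequentially"
    using contr by (elim tends_strongly_exists [OF sequentially_bot, rotated 2]) auto
  note lim = S [unfolded tends_strongly_def, rule_format]
  (* The iterates are contractions, so multiplication is jointly continuous along the sequence. *)
  have lim_a: "(\<lambda>n. app (a n) (y n)) \<longlonglongrightarrow> app S z" if "y \<longlonglongrightarrow> z" for y z
  proof -
    have "(\<lambda>n. app (a n) (y n - z)) \<longlonglongrightarrow> 0"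
    proof (rule Lim_null_comparison)
      show "\<forall>\<^sub>F n in sequentially. norm (app (a n) (y n - z)) \<le> norm (y n - z)"
        by (rule always_eventually) (blast intro: contr)
      show "(\<lambda>n. norm (y n - z)) \<longlonglongrightarrow> 0" using that by (simp add: LIM_zero tendsto_norm_zero)
    qed
    from tendsto_add [OF this lim [of z]] show ?thesis by simp
  qed
  have "a n \<in> N" for n
    by (induction n) (use A in \<open>auto simp: a_0 a_Suc W_def\<close>)
  then have SN: "S \<in> N" using S by (rule strong_limit_sequence)
  have adjS: "adj S = S" using a by (intro tends_strongly_self_adjoint [OF S]) auto
  have cube: "S * S * S = S"
  proof (rule operator_eqI)
    fix x
    have "(\<lambda>n. 2 *\<^sub>R app (a (Suc n)) x) \<longlonglongrightarrow> 2 *\<^sub>R app S x"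
      using LIMSEQ_Suc [OF lim] by (intro tendsto_scaleR tendsto_const)
    moreover have "2 *\<^sub>R app (a (Suc n)) x = 3 *\<^sub>R app (a n) x - app (a n) (app (a n) (app (a n) x))" for n
    proof -
      have "2 *\<^sub>R a (Suc n) = 2 *\<^sub>R a n + a n * (1 - a n * a n)"
        by (simp add: a_Suc W_def scaleR_right_distrib)
      then have "app (2 *\<^sub>R a (Suc n)) x = app (2 *\<^sub>R a n + a n * (1 - a n * a n)) x" by simp
      then show ?thesis by (simp add: scaleR_left_distrib [of 2 1, simplified])
    qed
    ultimately have "(\<lambda>n. 3 *\<^sub>R app (a n) x - app (a n) (app (a n) (app (a n) x))) \<longlonglongrightarrow> 2 *\<^sub>R app S x" by simp
    moreover have "(\<lambda>n. 3 *\<^sub>R app (a n) x - app (a n) (app (a n) (app (a n) x))) \<longlonglongrightarrow>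
        3 *\<^sub>R app S x - app S (app S (app S x))"
      by (intro tendsto_intros lim lim_a)
    ultimately have "2 *\<^sub>R app S x = 3 *\<^sub>R app S x - app S (app S (app S x))"
      using LIMSEQ_unique by blast
    then show "app (S * S * S) x = app S x"
      by (simp add: scaleR_left_distrib [of 2 1, simplified])
  qed
  have limA: "tends_strongly (\<lambda>n. A * a n) (A * S) sequentially"
    using S by (rule tends_strongly_mult_left)
  have AS_ge: "inner (app A x) (app A x) \<le> inner (app (A * S) x) x" for x
  proof (rule LIMSEQ_le_const)
    show "(\<lambda>n. inner (app (A * a n) x) x) \<longlonglongrightarrow> inner (app (A * S) x) x"
      using limA by (intro tendsto_inner tendsto_const) (simp add: tends_strongly_def)
    show "\<exists>m. \<forall>n\<ge>m. inner (app A x) (app A x) \<le> inner (app (A * a n) x) x"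
      using prod_le [of 0 _ x] self_adjoint_inner [OF A(2), of "app A x" x] by (simp add: a_0)
  qed
  have "A * S = S * A"
    using sequentially_bot limA tends_strongly_mult_right [OF S, of A]
    by (rule tends_strongly_unique) (simp add: a_comm)
  then have "adj (A * S) = A * S" using A adjS by simp
  then have pos: "is_positive (A * S)"
    using AS_ge order_trans [OF inner_ge_zero] by (simp only: is_positive_def) blast
  have "A * (S * S) = A"
  proof (rule operator_eqI)
    fix x
    (* \<open>S\<close> vanishes at \<open>?y\<close> because \<open>S\<^sup>3 = S\<close>, and the kernel of \<open>S\<close> is contained in that of \<open>A\<close>. *)
    let ?y = "x - app S (app S x)"
    have "app S ?y = app (S - S * S * S) x" by (simp add: mult.assoc)
    then have "app S ?y = 0" by (simp only: cube) simp
    then have "app (A * S) ?y = 0" unfolding app_simps by simp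
    then have "inner (app A ?y) (app A ?y) \<le> 0" using AS_ge [of ?y] by simp
    then have "inner (app A ?y) (app A ?y) = 0" by (rule antisym) (rule inner_ge_zero)
    then have "app A ?y = 0" by (simp only: inner_eq_zero_iff)
    then show "app (A * (S * S)) x = app A x" by simp
  qed
  moreover have "C * S = 0" if "C * A = 0" for C
  proof -
    have "C * a n = 0" for n
      by (induction n) (use that in \<open>auto simp: a_0 a_Suc distrib_left simp flip: mult.assoc\<close>)
    then show ?thesis
      by (intro tends_strongly_unique [OF sequentially_bot tends_strongly_mult_left [OF S] tends_strongly_const]) simp
  qed
  ultimately show ?thesis using SN adjS cube pos by (auto simp: sign_of_def)
qed

lemma sign_exists:
  assumes A: "A \<in> N" "adj A = A"
  shows "\<exists>S. sign_of A S"
proof -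
  obtain K where K: "K > 0" "\<And>x. norm (app A x) \<le> K * norm x" using app_bound [of A] by blast
  define B where "B = (1 / K) *\<^sub>R A"
  have "norm (app B x) \<le> norm x" for x using K(1) K(2) [of x] by (simp add: B_def field_simps)
  then have "inner (app (B * B) x) x \<le> inner x x" for x
    using norm_app_square [of B x] A power_mono [of "norm (app B x)" "norm x" 2]
    by (simp add: B_def power2_norm_eq_inner)
  then have "is_positive (1 - B * B)" using A by (simp add: is_positive_def B_def inner_diff_left)
  then obtain S where "sign_of B S"
    using contraction_sign [of B] A by (auto simp: B_def)
  moreover have AB: "A = K *\<^sub>R B" using K(1) by (simp add: B_def)
  ultimately have "sign_of A S"
    using K(1) positive_scaleR [of "B * S" K] by (auto simp: sign_of_def)
  then show ?thesis ..
qed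

end

section \<open>Projections and primeness\<close>

context strongly_closed_star_algebra
begin

definition projections :: "'a operator set" where
  "projections = {R \<in> N. adj R = R \<and> R * R = R}"

text \<open>\<open>S\<^sup>2\<close> for the sign \<open>S\<close> of \<open>T T\<^sup>*\<close>, an operator with the same closed range as \<open>T\<close>.\<close>

lemma range_projection:
  assumes T: "T \<in> N"
  obtains R where "R \<in> projections" "R * T = T"
    "\<And>C. C * T = 0 \<Longrightarrow> C * R = 0"
proof -
  let ?K = "T * adj T"
  obtain S where S: "sign_of ?K S" using sign_exists [of ?K] T by auto
  define R where "R = S * S"
  have R: "R \<in> N" "adj R = R" "R * R = R" "?K * R = ?K"
    using S by (auto simp: sign_of_def R_def) (metis mult.assoc)
  have "R * ?K = ?K" using arg_cong [OF R(4), of adj] R(2) by simp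
  then have "((1 - R) * T) * adj ((1 - R) * T) = 0"
    by (simp add: R algebra_simps) (metis mult.assoc)
  then have "(1 - R) * T = 0" by (rule mult_adj_eq_0)
  then have RT: "R * T = T" by (simp add: algebra_simps)
  have "C * R = 0" if "C * T = 0" for C
  proof -
    have "C * ?K = 0" using that by (simp flip: mult.assoc)
    then have "C * S = 0" using S by (simp add: sign_of_def)
    then show ?thesis by (simp add: R_def flip: mult.assoc)
  qed
  then show thesis using that R RT by (auto simp: projections_def)
qed

text \<open>\<open>P = (S\<^sup>2 + S)/2\<close> is the spectral projection for the positive half-line.  If it were \<open>0\<close>, then
\<open>A = A S\<^sup>2 = - A S\<close> would be negative; if it were \<open>1\<close>, then \<open>S = 1\<close> and \<open>A = A S\<close> would be
positive.\<close>

lemma nontrivial_projection: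
  assumes A: "A \<in> N" "adj A = A" and u: "inner (app A u) u < 0" and v: "0 < inner (app A v) v"
  obtains P where "P \<in> projections" "P \<noteq> 0" "P \<noteq> 1"
proof -
  obtain S where "sign_of A S" using sign_exists A by blast
  then have S: "S \<in> N" "adj S = S" "S * S * S = S" "A * (S * S) = A" "is_positive (A * S)"
    by (auto simp: sign_of_def)
  have S4: "S * (S * (S * S)) = S * S" "S * (S * S) = S" using S(3) by (simp_all add: mult.assoc)
  define P where "P = (1/2) *\<^sub>R (S * S + S)"
  have double: "P + P = S * S + S" by (simp add: P_def flip: scaleR_left_distrib)
  have "P * P = P"
    by (simp add: P_def algebra_simps S4 flip: scaleR_left_distrib)
  then have "P \<in> projections" using S by (simp add: projections_def P_def)
  moreover have "P \<noteq> 0"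
  proof
    assume "P = 0"
    then have "S * S = - S" using double by (simp add: eq_neg_iff_add_eq_0)
    then have "A = - (A * S)" using S(4) by simp
    then have "inner (app A v) v = - inner (app (A * S) v) v"
      by (metis app_simps(5) inner_minus_left)
    then show False using v S(5) by (metis is_positive_def neg_0_less_iff_less not_less)
  qed
  moreover have "P \<noteq> 1"
  proof
    assume "P = 1"
    then have *: "S * S = 1 + 1 - S" using double by (simp add: algebra_simps)
    then have "S = (1 + 1 - S) * S" using S(3) by simp
    then have "S + S = 1 + 1" using * by (simp add: algebra_simps)
    then have "2 *\<^sub>R S = 2 *\<^sub>R 1" by (simp add: scaleR_2)
    then have "S = 1" by simp
    then show False using u S(5) by (auto simp: is_positive_def not_le [symmetric])
  qed
  ultimately show thesis by (rule that)
qed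

text \<open>A self-adjoint operator whose Rayleigh quotient \<open>q\<close> is constant is a scalar.  Otherwise shifting
it by a number between two values of \<open>q\<close> produces a form that takes both signs.\<close>

lemma nontrivial_projection_exists:
  assumes T: "T \<in> N" and nonscalar: "\<And>r s. T \<noteq> r *\<^sub>R 1 + s *\<^sub>R imaginary_operator"
  obtains P where "P \<in> projections" "P \<noteq> 0" "P \<noteq> 1"
proof -
  have "\<exists>A\<in>N. adj A = A \<and> (\<forall>r. A \<noteq> r *\<^sub>R 1)"
  proof (rule ccontr)
    assume *: "\<not> ?thesis"
    let ?X = "(1/2) *\<^sub>R (T + adj T)" and ?Y = "(1/2) *\<^sub>R (imaginary_operator * (adj T - T))"
    have "adj ?X = ?X" by (simp add: add.commute)
    then obtain r where r: "?X = r *\<^sub>R 1" using * T by blast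
    have "adj ?Y = ?Y"
      by (simp add: imaginary_operator_central [of T] imaginary_operator_central [of "adj T"] algebra_simps)
    then obtain s where s: "?Y = s *\<^sub>R 1" using * T by blast
    have "imaginary_operator * ?Y = (1/2) *\<^sub>R (T - adj T)"
      by (simp add: imaginary_operator_square scaleR_right_diff_distrib flip: mult.assoc)
    then have "T = ?X + imaginary_operator * ?Y"
      by (simp add: scaleR_left_distrib [symmetric] algebra_simps)
    then show False using nonscalar [of r s] unfolding r s by simp
  qed
  then obtain A where A: "A \<in> N" "adj A = A" "\<And>r. A \<noteq> r *\<^sub>R 1" by blast
  define q where "q x = inner (app A x) x / inner x x" for x
  obtain u v where uv: "u \<noteq> 0" "v \<noteq> 0" "q u < q v"
  proof -
    have "\<exists>u v. u \<noteq> 0 \<and> v \<noteq> 0 \<and> q u \<noteq> q v"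
    proof (rule ccontr)
      assume "\<not> ?thesis"
      then obtain r where r: "\<And>x. x \<noteq> 0 \<Longrightarrow> q x = r" by metis
      have "inner (app (A - r *\<^sub>R 1) x) x = 0" for x
        using r [of x] by (cases "x = 0") (auto simp: q_def inner_diff_left field_simps)
      then have "A - r *\<^sub>R 1 = 0" using A(2) by (intro self_adjoint_eq_0) auto
      then show False using A(3) [of r] by simp
    qed
    then show thesis using that by (metis linorder_neqE)
  qed
  define l where "l = (q u + q v) / 2"
  have l: "q u < l" "l < q v" using uv(3) by (simp_all add: l_def)
  have "inner (app (A - l *\<^sub>R 1) u) u < 0" "0 < inner (app (A - l *\<^sub>R 1) v) v"
    using l uv(1,2) by (simp_all add: q_def inner_diff_left field_simps)
  then show thesis
    using A nontrivial_projection [of "A - l *\<^sub>R 1" u v] that by auto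
qed

end

locale trivial_center = strongly_closed_star_algebra +
  assumes central_projection:
    "E \<in> projections \<Longrightarrow> (\<And>A. A \<in> N \<Longrightarrow> E * A = A * E) \<Longrightarrow> E = 0 \<or> E = 1"
begin

text \<open>An upper bound of \<open>R1\<close> and \<open>R2\<close> is the range projection of \<open>R1 + R2\<close>: a vector killed by the
sum is killed by both summands, since these are positive.\<close>

lemma projection_order_directed:
  assumes A: "A \<in> N"
  defines "D \<equiv> {R \<in> projections. \<forall>Z\<in>N. A * Z * R = 0}"
  shows "directed_on D (\<lambda>R R'. R' * R = R)"
proof -
  have "0 \<in> D" using scaleR_closed [OF one_closed, of 0] by (simp add: D_def projections_def)
  moreover have "\<exists>R\<in>D. R * R1 = R1 \<and> R * R2 = R2" if "R1 \<in> D" "R2 \<in> D" for R1 R2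
  proof -
    note R12 = that [unfolded D_def projections_def, simplified]
    obtain R where R: "R \<in> projections" "R * (R1 + R2) = R1 + R2"
      "\<And>C. C * (R1 + R2) = 0 \<Longrightarrow> C * R = 0"
      using range_projection [of "R1 + R2"] R12 by auto
    have "R \<in> D" using R(1) R12 by (auto simp: D_def distrib_left intro!: R(3))
    have zero: "R1 * (1 - R) = 0 \<and> R2 * (1 - R) = 0"
    proof -
      have adjR: "adj R = R" using R(1) by (simp add: projections_def)
      have eq: "(R1 + R2) * (1 - R) = 0"
        using arg_cong [OF R(2), of adj] R12 adjR by (simp add: algebra_simps)
      have "app R1 (app (1 - R) x) = 0 \<and> app R2 (app (1 - R) x) = 0" for x
      proof -
        let ?y = "app (1 - R) x"
        have "inner (app ((R1 + R2) * (1 - R)) x) ?y = 0" unfolding eq by simp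
        then have "inner (app (R1 * R1) ?y) ?y + inner (app (R2 * R2) ?y) ?y = 0"
          using R12 by (simp only: app_simps inner_add_left)
        then have "(norm (app R1 ?y))\<^sup>2 + (norm (app R2 ?y))\<^sup>2 = 0"
          using R12 by (simp only: norm_app_square)
        then show ?thesis by (simp add: add_nonneg_eq_0_iff)
      qed
      then show ?thesis by (auto intro!: operator_eqI)
    qed
    have "R * R1 = R1" "R * R2 = R2"
      using arg_cong [OF conjunct1 [OF zero], of adj] arg_cong [OF conjunct2 [OF zero], of adj] R12 R(1)
      by (simp_all add: projections_def algebra_simps)
    then show ?thesis using \<open>R \<in> D\<close> by blast
  qed
  moreover have "R * R = R" if "R \<in> D" for R using that by (simp add: D_def projections_def)
  moreover have "R3 * R1 = R1" if "R2 * R1 = R1" "R3 * R2 = R2" for R1 R2 R3 :: "'a operator"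
    using that by (metis mult.assoc)
  ultimately show ?thesis
    unfolding directed_on_def by blast
qed

text \<open>The operators \<open>T\<close> with \<open>A N T = 0\<close> form a two-sided ideal.  The limit \<open>E\<close> of its projections is
a left unit for it (\<open>absorb\<close>), and this forces \<open>E U E = U E\<close> for all \<open>U\<close>; applied to \<open>U\<close> and to
\<open>U\<^sup>*\<close> this says that \<open>E\<close> is central.\<close>

lemma prime:
  assumes A: "A \<in> N" and B: "B \<in> N" and AB: "\<And>Z. Z \<in> N \<Longrightarrow> A * Z * B = 0"
  shows "A = 0 \<or> B = 0"
proof -
  define D where "D = {R \<in> projections. \<forall>Z\<in>N. A * Z * R = 0}"
  define F where "F = tail_filter D (\<lambda>R R'. R' * R = R)"
  have directed: "directed_on D (\<lambda>R R'. R' * R = R)"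
    unfolding D_def by (rule projection_order_directed [OF A])
  have nonbot: "F \<noteq> bot" unfolding F_def by (rule tail_filter_not_bot [OF directed])
  have D: "R \<in> N" "adj R = R" "R * R = R" "\<And>Z. Z \<in> N \<Longrightarrow> A * Z * R = 0" if "R \<in> D" for R
    using that by (auto simp: D_def projections_def)
  have inner_D: "inner (app R x) (app R' x) = (norm (app R x))\<^sup>2"
    if "R \<in> D" "R' \<in> D" "R' * R = R" for R R' x
  proof -
    have "inner (app R x) (app R' x) = inner (app (R' * R) x) x"
      using D(2) [OF that(2)] by (simp add: self_adjoint_inner)
    also have "\<dots> = inner (app (R * R) x) x" using that D(3) by simp
    also have "\<dots> = (norm (app R x))\<^sup>2" using D(2) that by (simp add: norm_app_square)
    finally show ?thesis .
  qed
  have contr: "norm (app R x) \<le> norm x" if "R \<in> D" for R x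
  proof -
    have "(norm (app R x))\<^sup>2 = inner (app R x) x"
      using norm_app_square [OF D(2) [OF that], of x] D(3) [OF that] by simp
    also have "\<dots> \<le> norm (app R x) * norm x" by (rule norm_cauchy_schwarz)
    finally show ?thesis by (cases "app R x = 0") (simp_all add: power2_eq_square)
  qed
  have ev: "eventually (\<lambda>R. R \<in> D) F"
  proof -
    obtain i where "i \<in> D" using directed by (auto simp: directed_on_def)
    from eventually_tail_filter [OF this] show ?thesis
      unfolding F_def by (rule eventually_mono) simp
  qed
  have conv: "\<exists>l. ((\<lambda>R. app R x) \<longlongrightarrow> l) F" for x
    unfolding F_def
  proof (rule convergent_along_directed_set [OF directed, where \<psi> = "\<lambda>R. (norm (app R x))\<^sup>2" and c = "(norm x)\<^sup>2"])
    fix R R' assume R: "R \<in> D" "R' \<in> D" "R' * R = R"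
    show "(norm (app R' x - app R x))\<^sup>2 \<le> (norm (app R' x))\<^sup>2 - (norm (app R x))\<^sup>2"
      using inner_D [OF R, of x]
      by (simp add: power2_norm_eq_inner inner_diff_left inner_diff_right inner_commute)
  qed (simp add: power_mono contr)
  have "eventually (\<lambda>R. \<forall>x. norm (app R x) \<le> norm x) F"
    using ev by (rule eventually_mono) (simp add: contr)
  then obtain E where E: "tends_strongly (\<lambda>R. R) E F"
    by (rule tends_strongly_exists [OF nonbot conv])
  have EN: "E \<in> N"
    using nonbot _ E by (rule strong_limit) (rule eventually_mono [OF ev], rule D)
  have adjE: "adj E = E"
    using E nonbot by (rule tends_strongly_self_adjoint) (rule eventually_mono [OF ev], rule D)
  have ER: "E * R = R" if "R \<in> D" for R
  proof -
    have "eventually (\<lambda>R'. R' * R = R) F"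
      using eventually_tail_filter [OF that, of "\<lambda>R R'. R' * R = R"]
      unfolding F_def by (rule eventually_mono) simp
    then show ?thesis
      by (rule tends_strongly_unique [OF nonbot tends_strongly_mult_right [OF E] tends_strongly_const])
  qed
  have absorb: "E * T = T" if T: "T \<in> N" and AT: "\<And>Z. Z \<in> N \<Longrightarrow> A * Z * T = 0" for T
  proof -
    obtain R where R: "R \<in> projections" "R * T = T" "\<And>C. C * T = 0 \<Longrightarrow> C * R = 0"
      using range_projection [OF T] by blast
    then have "R \<in> D" using AT by (simp add: D_def)
    then show ?thesis using ER R(2) by (metis mult.assoc)
  qed
  (* Identities on all projections in the ideal pass to the limit \<open>E\<close>. *)
  have limit_eq: "C * E = C' * E" if "\<And>R. R \<in> D \<Longrightarrow> C * R = C' * R" for C C'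
    using eventually_mono [OF ev that]
    by (rule tends_strongly_unique [OF nonbot tends_strongly_mult_left [OF E] tends_strongly_mult_left [OF E]])
  have EUE: "E * U * E = U * E" if "U \<in> N" for U
  proof (rule limit_eq)
    fix R assume R: "R \<in> D"
    have "A * Z * (U * R) = 0" if "Z \<in> N" for Z
      using D(4) [OF R, of "Z * U"] that \<open>U \<in> N\<close> by (simp add: mult.assoc)
    then show "E * U * R = U * R"
      using absorb [of "U * R"] D(1) [OF R] \<open>U \<in> N\<close> by (simp add: mult.assoc)
  qed
  have "E * E = E" using limit_eq [of E 1] ER by simp
  then have proj: "E \<in> projections" using EN adjE by (simp add: projections_def)
  have "E * U = U * E" if "U \<in> N" for U
  proof -
    have "adj (E * adj U * E) = adj (adj U * E)" using EUE [of "adj U"] that by simp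
    then have "E * U * E = E * U" using adjE by (simp add: mult.assoc)
    then show ?thesis using EUE [OF that] by simp
  qed
  then consider "E = 0" | "E = 1" using central_projection [OF proj] by blast
  then show ?thesis
  proof cases
    case 1
    then show ?thesis using absorb [OF B AB] by simp
  next
    case 2
    have "A * E = 0 * E" by (rule limit_eq) (use D(4) [of _ 1] in simp)
    then show ?thesis using 2 by simp
  qed
qed

end

section \<open>Factor von Neumann algebras\<close>

lemma tendsto_cinner_left:
  assumes "tends_strongly f S F"
  shows "((\<lambda>i. cinner (app (f i) x) y) \<longlongrightarrow> cinner (app S x) y) F"
proof -
  have "((\<lambda>i. inner (app (f i) z) y) \<longlongrightarrow> inner (app S z) y) F" for z
    using assms by (intro tendsto_inner tendsto_const) (simp add: tends_strongly_def)
  then show ?thesis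
    unfolding cinner_eq_inner app_scaleC [symmetric] by (intro tendsto_Complex tendsto_minus)
qed

text \<open>Strong convergence implies convergence of all matrix coefficients, which is convergence in the
pulled-back product topology.\<close>

lemma von_neumann_algebra_strong_limit:
  assumes M: "von_neumann_algebra M" and F: "F \<noteq> bot"
    and ev: "eventually (\<lambda>T. to_blinfun T \<in> M) F" and S: "tends_strongly (\<lambda>T. T) S F"
  shows "to_blinfun S \<in> M"
proof (rule limitin_closedin)
  show "closedin weak_operator_topology M" using M by (simp add: von_neumann_algebra_def)
  show "eventually (\<lambda>T. to_blinfun T \<in> M) F" "\<not> trivial_limit F" by fact+
  let ?c = "\<lambda>A (x, y). cinner (blinfun_apply A x) y"
  let ?prod = "product_topology (\<lambda>_::'a \<times> 'a. euclidean :: complex topology) UNIV"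
  have lim: "limitin ?prod (\<lambda>T. ?c (to_blinfun T)) (?c (to_blinfun S)) F"
    unfolding limitin_componentwise
    using tendsto_cinner_left [OF S] by (auto simp: app.rep_eq)
  show "limitin weak_operator_topology to_blinfun (to_blinfun S) F"
    unfolding limitin_def
  proof (intro conjI allI impI)
    show "to_blinfun S \<in> topspace weak_operator_topology"
      by (simp add: weak_operator_topology_def topspace_pullback_topology to_blinfun)
    fix U assume "openin weak_operator_topology U \<and> to_blinfun S \<in> U"
    then obtain V where V: "openin ?prod V" "U = ?c -` V \<inter> bounded_operators" "?c (to_blinfun S) \<in> V"
      unfolding weak_operator_topology_def openin_pullback_topology by blast
    then have "eventually (\<lambda>T. ?c (to_blinfun T) \<in> V) F" using lim unfolding limitin_def by blast
    then show "eventually (\<lambda>T. to_blinfun T \<in> U) F"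
      unfolding V(2) by (simp add: to_blinfun)
  qed
qed

lemma von_neumann_algebra_strongly_closed:
  assumes M: "von_neumann_algebra M"
  shows "strongly_closed_star_algebra {T. to_blinfun T \<in> M}"
proof
  note M' = M [unfolded von_neumann_algebra_def]
  have scaleC: "c *\<^sub>C A \<in> M" if "A \<in> M" for c A
    using M' that by (simp add: complex_vector.subspace_def)
  fix S T :: "'a operator" and r :: real and F
  show "S \<in> {T. to_blinfun T \<in> M} \<Longrightarrow> T \<in> {T. to_blinfun T \<in> M} \<Longrightarrow> S + T \<in> {T. to_blinfun T \<in> M}"
    using M' by (simp add: plus_operator.rep_eq complex_vector.subspace_def)
  show "S \<in> {T. to_blinfun T \<in> M} \<Longrightarrow> T \<in> {T. to_blinfun T \<in> M} \<Longrightarrow> S * T \<in> {T. to_blinfun T \<in> M}"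
    using M' by (simp add: times_operator.rep_eq)
  show "S \<in> {T. to_blinfun T \<in> M} \<Longrightarrow> r *\<^sub>R S \<in> {T. to_blinfun T \<in> M}"
    by (simp add: scaleR_operator.rep_eq scaleR_scaleC scaleC)
  show "S \<in> {T. to_blinfun T \<in> M} \<Longrightarrow> adj S \<in> {T. to_blinfun T \<in> M}"
    using M' by (simp add: adj.rep_eq)
  show "1 \<in> {T. to_blinfun T \<in> M}"
    using M' by (simp add: one_operator.rep_eq)
  show "imaginary_operator \<in> {T. to_blinfun T \<in> M}"
    using M' scaleC by (simp add: imaginary_operator.rep_eq)
  show "S \<in> {T. to_blinfun T \<in> M}"
    if "F \<noteq> bot" "eventually (\<lambda>T. T \<in> {T. to_blinfun T \<in> M}) F" "tends_strongly (\<lambda>T. T) S F"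
    using von_neumann_algebra_strong_limit [OF M that(1) _ that(3)] that(2) by simp
qed

text \<open>A central projection is a scalar \<open>c\<close> with \<open>c\<^sup>2 = c\<close>, except on the zero space, where
\<open>0 = 1\<close>.\<close>

lemma factor_trivial_center:
  assumes "factor_von_neumann_algebra M"
  shows "trivial_center {T. to_blinfun T \<in> M}"
proof -
  have M: "von_neumann_algebra M" and center: "center M \<subseteq> {c *\<^sub>C id_blinfun | c. True}"
    using assms by (auto simp: factor_von_neumann_algebra_def)
  interpret strongly_closed_star_algebra "{T. to_blinfun T \<in> M}"
    by (rule von_neumann_algebra_strongly_closed [OF M])
  show ?thesis
  proof
    fix E assume E: "E \<in> projections" and comm: "\<And>A. A \<in> {T. to_blinfun T \<in> M} \<Longrightarrow> E * A = A * E"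
    have "to_blinfun E o\<^sub>L A = A o\<^sub>L to_blinfun E" if "A \<in> M" for A
    proof -
      have "A \<in> bounded_operators" using M that by (auto simp: von_neumann_algebra_def)
      then have A: "to_blinfun (of_blinfun A) = A" by (rule of_blinfun_inverse)
      then have "E * of_blinfun A = of_blinfun A * E" using comm that by simp
      then have "to_blinfun (E * of_blinfun A) = to_blinfun (of_blinfun A * E)" by simp
      then show ?thesis by (simp add: times_operator.rep_eq A)
    qed
    then have "to_blinfun E \<in> center M" using E by (simp add: center_def projections_def)
    then obtain c where "to_blinfun E = c *\<^sub>C id_blinfun" using center by blast
    then have c: "app E x = c *\<^sub>C x" for x by (simp add: app.rep_eq scaleC_blinfun.rep_eq)
    have "E * E = E" using E by (simp add: projections_def)
    then have "app (E * E) x = app E x" for x by simp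
    then have "c = 0 \<or> c = 1 \<or> x = 0" for x :: 'a
      using c [of x] by (simp add: c)
    then consider "c = 0" | "c = 1" | "\<And>x::'a. x = 0" by blast
    then show "E = 0 \<or> E = 1"
    proof cases
      case 1
      then show ?thesis by (intro disjI1 operator_eqI) (simp add: c)
    next
      case 2
      then show ?thesis by (intro disjI2 operator_eqI) (simp add: c)
    next
      case 3
      then show ?thesis by (intro disjI1 operator_eqI) metis
    qed
  qed
qed

text \<open>Two distinct elements of an independent set are not both multiples of the identity.\<close>

lemma nonscalar_exists:
  assumes "cdim_at_least 2 M"
  shows "\<exists>A\<in>M. \<forall>c. A \<noteq> c *\<^sub>C id_blinfun"
proof (rule ccontr)
  assume "\<not> ?thesis"
  then have scalar: "\<exists>c. A = c *\<^sub>C id_blinfun" if "A \<in> M" for A using that by blast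
  obtain B where B: "B \<subseteq> M" "complex_vector.independent B" "infinite B \<or> 2 \<le> card B"
    using assms by (auto simp: cdim_at_least_def)
  have "\<not> (\<forall>a\<in>B. \<forall>b\<in>B. a = b)"
  proof
    assume eq: "\<forall>a\<in>B. \<forall>b\<in>B. a = b"
    then have "B = {} \<or> (\<exists>b. B = {b})" by blast
    then show False using B(3) by auto
  qed
  then obtain a b where ab: "a \<in> B" "b \<in> B" "a \<noteq> b" by blast
  obtain c d where cd: "a = c *\<^sub>C id_blinfun" "b = d *\<^sub>C id_blinfun"
    using scalar B(1) ab by blast
  have "a \<noteq> 0" using B(2) ab complex_vector.dependent_zero by blast
  then have "c \<noteq> 0" using cd by auto
  then have "b = (d / c) *\<^sub>C a" by (simp add: cd)
  moreover have "a \<in> B - {b}" using ab by simp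
  ultimately have "b \<in> complex_vector.span (B - {b})"
    by (metis complex_vector.span_base complex_vector.span_scale)
  then show False using B(2) ab(2) by (auto simp: complex_vector.dependent_def)
qed

theorem corollary3p3:
  fixes M :: "('a::chilbert_space \<Rightarrow>\<^sub>L 'a) set"
    and \<Phi> :: "('a \<Rightarrow>\<^sub>L 'a) \<Rightarrow> ('a \<Rightarrow>\<^sub>L 'a)"
  assumes "factor_von_neumann_algebra M"
    and "cdim_at_least 2 M"
    and "\<Phi> \<in> M \<rightarrow> M"
  shows "mixed_jordan_triple_star_derivation M \<Phi> \<longleftrightarrow> additive_star_derivation M \<Phi>"
proof -
  have M: "von_neumann_algebra M" using assms(1) by (simp add: factor_von_neumann_algebra_def)
  define N where "N = {T. to_blinfun T \<in> M}"
  interpret N: trivial_center N unfolding N_def by (rule factor_trivial_center [OF assms(1)])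
  interpret A: unital_star_algebra N adj imaginary_operator
    by standard (auto simp: imaginary_operator_square intro: imaginary_operator_central)
  have in_M: "A \<in> M \<Longrightarrow> to_blinfun (of_blinfun A) = A" for A
    using M by (intro of_blinfun_inverse) (auto simp: von_neumann_algebra_def)
  have in_N: "T \<in> N \<longleftrightarrow> to_blinfun T \<in> M" for T by (simp add: N_def)
  have ball_M: "(\<forall>A\<in>M. Q A) \<longleftrightarrow> (\<forall>T\<in>N. Q (to_blinfun T))" for Q
  proof (intro iffI ballI)
    fix A assume "\<forall>T\<in>N. Q (to_blinfun T)" "A \<in> M"
    moreover from \<open>A \<in> M\<close> have "of_blinfun A \<in> N" by (simp add: in_N in_M)
    ultimately have "Q (to_blinfun (of_blinfun A))" by blast
    then show "Q A" unfolding in_M [OF \<open>A \<in> M\<close>] .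
  qed (simp add: in_N)
  (* The map \<open>\<Phi>\<close> transported to the type of operators; its values outside \<open>N\<close> are arbitrary. *)
  define \<Psi> where "\<Psi> T = of_blinfun (\<Phi> (to_blinfun T))" for T
  have \<Phi>_M: "\<Phi> (to_blinfun T) \<in> M" if "T \<in> N" for T
    using assms(3) that by (auto simp: in_N)
  then have \<Phi>_\<Psi>: "\<Phi> (to_blinfun T) = to_blinfun (\<Psi> T)" if "T \<in> N" for T
    using that by (simp add: \<Psi>_def in_M)
  have \<Psi>_N: "\<Psi> T \<in> N" if "T \<in> N" for T
    using \<Phi>_M [OF that] unfolding in_N \<Phi>_\<Psi> [OF that] .
  note rep = to_blinfun_inject plus_operator.rep_eq [symmetric] minus_operator.rep_eq [symmetric]
    times_operator.rep_eq [symmetric] adj.rep_eq [symmetric]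
  have triple_rep: "[to_blinfun A \<bullet>\<^sub>* to_blinfun B, to_blinfun C]\<^sub>* = to_blinfun (A.triple A B C)" for A B C
    by (simp add: skew_lie_product_def jordan_star_product_def A.triple_def A.skew_def rep
      del: adj_simps)
  have mixed: "mixed_jordan_triple_star_derivation M \<Phi> \<longleftrightarrow> (\<forall>A\<in>N. \<forall>B\<in>N. \<forall>C\<in>N.
      \<Psi> (A.triple A B C) = A.triple (\<Psi> A) B C + A.triple A (\<Psi> B) C + A.triple A B (\<Psi> C))"
    unfolding mixed_jordan_triple_star_derivation_def ball_M
    by (intro ball_cong refl) (simp add: triple_rep \<Phi>_\<Psi> rep)
  have derivation: "additive_star_derivation M \<Phi> \<longleftrightarrow>
      (\<forall>A\<in>N. \<forall>B\<in>N. \<Psi> (A + B) = \<Psi> A + \<Psi> B) \<and> (\<forall>A\<in>N. \<forall>B\<in>N. \<Psi> (A * B) = \<Psi> A * B + A * \<Psi> B) \<and>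
      (\<forall>A\<in>N. \<Psi> (adj A) = adj (\<Psi> A))"
    unfolding additive_star_derivation_def ball_M
    by (intro conj_cong ball_cong refl) (simp_all add: \<Phi>_\<Psi> rep)
  obtain T where T: "T \<in> N" "\<And>c. to_blinfun T \<noteq> c *\<^sub>C id_blinfun"
    using nonscalar_exists [OF assms(2)] in_M in_N by metis
  have "T \<noteq> r *\<^sub>R 1 + s *\<^sub>R imaginary_operator" for r s
  proof
    assume "T = r *\<^sub>R 1 + s *\<^sub>R imaginary_operator"
    then have "to_blinfun T = (of_real r + of_real s * \<i>) *\<^sub>C id_blinfun"
      by (simp add: plus_operator.rep_eq scaleR_operator.rep_eq one_operator.rep_eq imaginary_operator.rep_eq
          scaleR_scaleC scaleC_add_left scaleC_scaleC)
    then show False using T(2) by blast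
  qed
  then obtain P where P: "P \<in> N.projections" "P \<noteq> 0" "P \<noteq> 1"
    using N.nontrivial_projection_exists [OF T(1)] by metis
  show ?thesis
  proof
    assume "mixed_jordan_triple_star_derivation M \<Phi>"
    then interpret prime_mixed_triple_derivation N adj imaginary_operator \<Psi> P
      using \<Psi>_N P N.prime unfolding mixed N.projections_def by unfold_locales auto
    show "additive_star_derivation M \<Phi>"
      unfolding derivation using additive map_mult map_star by blast
  next
    assume "additive_star_derivation M \<Phi>"
    then show "mixed_jordan_triple_star_derivation M \<Phi>"
      unfolding derivation mixed using \<Psi>_N by (intro ballI A.derivation_triple) auto
  qed
qed

end
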